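(* Let $\mathcal{A}$ be a generic arrangement of $r\ge n$ hyperplanes in $K^n$ ($n\ge2$), let $m\geq 1$ be an integer with $m<r-n+1$, and fix $m$ distinct hyperplanes $H_1,\ldots,H_m\in\mathcal{A}$. Put $\Xi^{(m)}(\mathcal{A}):=\{\theta\in D^{(m)}(\mathcal{A})\mid \theta*(p_{H_1}\cdots p_{H_m})=0\}$. Then $$D^{(m)}(\mathcal{A})=\Xi^{(m)}(\mathcal{A})\oplus S\epsilon_m=\Bigl(\sum_{\mathcal{H}\in\mathcal{A}^{(n-1)},\ \mathcal{H}\cap\{H_1,\ldots,H_m\}\neq\emptyset}SP_{\mathcal{H}}\delta_{\mathcal{H}}^m\Bigr)\oplus S\epsilon_m .$$ Moreover, the set $\{P_{\mathcal{H}}\delta_{\mathcal{H}}^m\mid \mathcal{H}\in\mathcal{A}^{(n-1)},\ \mathcal{H}\cap\{H_1,\ldots,H_m\}\ne\emptyset\}$ is a minimal system of generators for $\Xi^{(m)}(\mathcal{A})$ over $S$.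
   Context: $K$ is a field of characteristic zero and $S=K[x_1,\ldots,x_n]$. All hyperplanes are linear (pass through the origin of $K^n$); an arrangement is a finite set of distinct hyperplanes; it is generic if every $n$ of its hyperplanes intersect only at the origin. For each $H\in\mathcal{A}$, $p_H\in S$ is a fixed linear form defining $H$, and $Q=\prod_{H\in\mathcal{A}}p_H$. $D(S)=S\langle\partial_1,\ldots,\partial_n\rangle$ is the $n$th Weyl algebra, acting on $S$ by $*$; $D^{(m)}(S)=\bigoplus_{|\alpha|=m}S\partial^\alpha$. $D(\mathcal{A})=\{\theta\in D(S)\mid \theta*(QS)\subseteq QS\}$ and $D^{(m)}(\mathcal{A})=D(\mathcal{A})\cap D^{(m)}(S)$. For a finite set $\mathcal{S}$, $\mathcal{S}^{(k)}$ is the set of its subsets of cardinality $k$. For $\mathcal{H}\in\mathcal{A}^{(n-1)}$, $\delta_{\mathcal{H}}$ is a fixed nonzero element of the one-dimensional space $\{\delta\in\sum_{i=1}^nK\partial_i\mid \delta*p_H=0 \text{ for all } H\in\mathcal{H}\}$, and $P_{\mathcal{H}}=\prod_{H\in\mathcal{A}\setminus\mathcal{H}}p_H$. The Euler operator of order $m$ is $\epsilon_m=\sum_{|\alpha|=m}\frac{m!}{\alpha!}x^\alpha\partial^\alpha$. *)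

theory Defs
  imports
    "HOL-Analysis.Cartesian_Space"
    "HOL-Library.Poly_Mapping"
    "HOL-Library.Function_Algebras"
begin

text \<open>
  The polynomial ring \<open>S = K[x\<^sub>1,\<dots>,x\<^sub>n]\<close> is the monoid algebra over \<open>K = 'k\<close> of the exponent
  vectors \<open>'n \<Rightarrow>\<^sub>0 nat\<close>, with the variables indexed by a finite type \<open>'n\<close>, so that \<open>n = CARD('n)\<close>.
\<close>

type_synonym ('k, 'n) mpoly = "('n \<Rightarrow>\<^sub>0 nat) \<Rightarrow>\<^sub>0 'k"

definition Const :: "'k::field_char_0 \<Rightarrow> ('k, 'n::finite) mpoly" where
  "Const c = Poly_Mapping.single 0 c"

definition Var :: "'n::finite \<Rightarrow> ('k::field_char_0, 'n) mpoly" where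
  "Var i = Poly_Mapping.single (Poly_Mapping.single i 1) 1"

definition mpoly_eval :: "('k::field_char_0)^('n::finite) \<Rightarrow> ('k, 'n) mpoly \<Rightarrow> 'k" where
  "mpoly_eval v f =
     (\<Sum>\<alpha>\<in>Poly_Mapping.keys f. Poly_Mapping.lookup f \<alpha> * (\<Prod>i\<in>UNIV. (v $ i) ^ Poly_Mapping.lookup \<alpha> i))"

definition linear_form :: "('k::field_char_0)^('n::finite) \<Rightarrow> ('k, 'n) mpoly" where
  "linear_form c = (\<Sum>i\<in>UNIV. Const (c $ i) * Var i)"

definition partial :: "'n::finite \<Rightarrow> ('k::field_char_0, 'n) mpoly \<Rightarrow> ('k, 'n) mpoly" where
  "partial i f =
     (\<Sum>\<alpha>\<in>Poly_Mapping.keys f.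
        Poly_Mapping.single (\<alpha> - Poly_Mapping.single i 1)
          (of_nat (Poly_Mapping.lookup \<alpha> i) * Poly_Mapping.lookup f \<alpha>))"

text \<open>
  As \<open>K\<close> has characteristic zero, the Weyl algebra acts faithfully on \<open>S\<close>; its elements are
  represented by the maps \<open>S \<Rightarrow> S\<close> they induce. Thus \<open>\<theta> * f\<close> becomes \<open>\<theta> f\<close>, the product of operators
  is composition, and \<open>op_scale\<close> is the left multiplication by elements of \<open>S\<close>. The pointwise
  product on function types supplied by \<open>Function_Algebras\<close> is never used.
\<close>

type_synonym ('k, 'n) mop = "('k, 'n) mpoly \<Rightarrow> ('k, 'n) mpoly"

definition op_scale :: "('k::field_char_0, 'n::finite) mpoly \<Rightarrow> ('k, 'n) mop \<Rightarrow> ('k, 'n) mop" where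
  "op_scale s \<theta> = (\<lambda>f. s * \<theta> f)"

interpretation ops: module "op_scale :: ('k::field_char_0, 'n::finite) mpoly \<Rightarrow> ('k, 'n) mop \<Rightarrow> ('k, 'n) mop"
  by unfold_locales (auto simp: op_scale_def fun_eq_iff algebra_simps)

inductive_set weyl_algebra :: "('k::field_char_0, 'n::finite) mop set" where
  mult: "(\<lambda>f. s * f) \<in> weyl_algebra"
| partial: "partial i \<in> weyl_algebra"
| add: "\<theta> \<in> weyl_algebra \<Longrightarrow> \<eta> \<in> weyl_algebra \<Longrightarrow> \<theta> + \<eta> \<in> weyl_algebra"
| comp: "\<theta> \<in> weyl_algebra \<Longrightarrow> \<eta> \<in> weyl_algebra \<Longrightarrow> \<theta> \<circ> \<eta> \<in> weyl_algebra"

definition mdeg :: "('n::finite \<Rightarrow>\<^sub>0 nat) \<Rightarrow> nat" where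
  "mdeg \<alpha> = (\<Sum>i\<in>UNIV. Poly_Mapping.lookup \<alpha> i)"

lemma finite_mdeg_eq: "finite {\<alpha> :: 'n::finite \<Rightarrow>\<^sub>0 nat. mdeg \<alpha> = m}"
proof -
  have fin: "finite {f :: 'n \<Rightarrow> nat. \<forall>i. f i \<in> {..m}}"
    using finite_PiE[of "UNIV :: 'n set" "\<lambda>_. {..m}"] by (simp add: PiE_def Pi_def)
  have "Poly_Mapping.lookup \<alpha> i \<le> mdeg \<alpha>" for \<alpha> :: "'n \<Rightarrow>\<^sub>0 nat" and i
    unfolding mdeg_def by (rule member_le_sum) auto
  then have "Poly_Mapping.lookup ` {\<alpha> :: 'n \<Rightarrow>\<^sub>0 nat. mdeg \<alpha> = m} \<subseteq> {f. \<forall>i. f i \<in> {..m}}"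
    by auto
  then have "finite (Poly_Mapping.lookup ` {\<alpha> :: 'n \<Rightarrow>\<^sub>0 nat. mdeg \<alpha> = m})"
    using fin by (rule finite_subset)
  then show ?thesis
    by (rule finite_imageD) (simp add: inj_on_def poly_mapping_eqI)
qed

text \<open>
  \<open>\<partial>\<^sup>\<alpha>\<close> is the composition of all \<open>\<partial>\<^sub>i\<^bsup>\<alpha>\<^sub>i\<^esup>\<close>; the order is immaterial, see \<open>comp_fun_commute_partial\<close>.
\<close>

definition partial_pow :: "('n::finite \<Rightarrow>\<^sub>0 nat) \<Rightarrow> ('k::field_char_0, 'n) mop" where
  "partial_pow \<alpha> = Finite_Set.fold (\<lambda>i \<theta>. (partial i ^^ Poly_Mapping.lookup \<alpha> i) \<circ> \<theta>) id UNIV"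

lemma lookup_partial:
  "Poly_Mapping.lookup (partial i f) \<beta> =
     of_nat (Suc (Poly_Mapping.lookup \<beta> i)) * Poly_Mapping.lookup f (\<beta> + Poly_Mapping.single i 1)"
proof -
  let ?e = "Poly_Mapping.single i (1::nat)" and ?l = Poly_Mapping.lookup
  let ?g = "\<lambda>\<alpha>. of_nat (?l \<alpha> i) * ?l f \<alpha>"
  have eq: "(?g \<alpha> when \<alpha> - ?e = \<beta>) = (if \<alpha> = \<beta> + ?e then ?g \<alpha> else 0)" for \<alpha>
  proof (cases "?l \<alpha> i = 0")
    case True
    then have "\<alpha> \<noteq> \<beta> + ?e" by (auto simp: lookup_add)
    then show ?thesis using True by simp
  next
    case False
    then have "\<alpha> - ?e + ?e = \<alpha>"
      by (intro poly_mapping_eqI) (auto simp: lookup_add lookup_minus lookup_single when_def)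
    then have "\<alpha> - ?e = \<beta> \<longleftrightarrow> \<alpha> = \<beta> + ?e" by (metis add_diff_cancel_right')
    then show ?thesis by (simp add: when_def)
  qed
  have "?l (partial i f) \<beta> = (\<Sum>\<alpha>\<in>Poly_Mapping.keys f. ?g \<alpha> when \<alpha> - ?e = \<beta>)"
    by (simp add: partial_def lookup_sum lookup_single)
  also have "\<dots> = ?g (\<beta> + ?e)"
    by (subst sum.cong[OF refl eq]) (auto simp: sum.delta in_keys_iff)
  finally show ?thesis by (simp add: lookup_add)
qed

lemma partial_commute: "partial i (partial j f) = partial j (partial i f)"
proof (cases "i = j")
  case False
  then show ?thesis
    by (intro poly_mapping_eqI)
       (simp add: lookup_partial lookup_add lookup_single algebra_simps)
qed simp

lemma comp_fun_commute_partial: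
  "comp_fun_commute (\<lambda>i (\<theta> :: ('k::field_char_0, 'n::finite) mop). (partial i ^^ h i) \<circ> \<theta>)"
proof
  fix i j
  have 1: "partial i ((partial j ^^ b) f) = (partial j ^^ b) (partial i f)" for b and f :: "('k,'n) mpoly"
  proof (induction b)
    case (Suc b)
    show ?case
      using partial_commute[of i j "(partial j ^^ b) f"] Suc.IH by simp
  qed simp
  have "(partial i ^^ a) ((partial j ^^ b) f) = (partial j ^^ b) ((partial i ^^ a) f)"
    for a b and f :: "('k,'n) mpoly"
    by (induction a) (simp_all add: 1)
  then show "(\<circ>) (partial j ^^ h j) \<circ> (\<circ>) (partial i ^^ h i) =
      (\<circ>) (partial i ^^ h i) \<circ> ((\<circ>) (partial j ^^ h j) :: ('k,'n) mop \<Rightarrow> _)"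
    by (simp add: fun_eq_iff)
qed

definition hom_ops :: "nat \<Rightarrow> ('k::field_char_0, 'n::finite) mop set" where
  "hom_ops m = ops.span {partial_pow \<alpha> | \<alpha>. mdeg \<alpha> = m}"

definition euler_op :: "nat \<Rightarrow> ('k::field_char_0, 'n::finite) mop" where
  "euler_op m =
     (\<Sum>\<alpha> | mdeg \<alpha> = m.
        op_scale (Const (fact m / (\<Prod>i\<in>UNIV. fact (Poly_Mapping.lookup \<alpha> i))) * Poly_Mapping.single \<alpha> 1)
          (partial_pow \<alpha>))"

text \<open>The space \<open>\<Sum>\<^sub>i K \<partial>\<^sub>i\<close> of constant derivations.\<close>

definition const_derivs :: "('k::field_char_0, 'n::finite) mop set" where
  "const_derivs = {\<Sum>i\<in>UNIV. op_scale (Const (c $ i)) (partial i) | c :: 'k^'n. True}"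

definition hyperplane :: "(('k::field_char_0)^('n::finite)) set \<Rightarrow> bool" where
  "hyperplane H \<longleftrightarrow> vec.subspace H \<and> vec.dim H = CARD('n) - 1"

definition arrangement :: "(('k::field_char_0)^('n::finite)) set set \<Rightarrow> bool" where
  "arrangement A \<longleftrightarrow> finite A \<and> (\<forall>H\<in>A. hyperplane H)"

definition generic_arrangement :: "(('k::field_char_0)^('n::finite)) set set \<Rightarrow> bool" where
  "generic_arrangement A \<longleftrightarrow>
     arrangement A \<and> (\<forall>T. T \<subseteq> A \<and> card T = CARD('n) \<longrightarrow> \<Inter>T = {0})"

definition defining_form :: "('k::field_char_0, 'n::finite) mpoly \<Rightarrow> ('k^'n) set \<Rightarrow> bool" where
  "defining_form f H \<longleftrightarrow> (\<exists>c. f = linear_form c) \<and> H = {v. mpoly_eval v f = 0}"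

definition k_subsets :: "'a set \<Rightarrow> nat \<Rightarrow> 'a set set" where
  "k_subsets A k = {T. T \<subseteq> A \<and> finite T \<and> card T = k}"

text \<open>
  In the following, \<open>p H\<close> is the chosen defining form of \<open>H \<in> A\<close>, and \<open>\<delta> T\<close> the chosen
  derivation attached to a set \<open>T\<close> of \<open>n - 1\<close> hyperplanes.
\<close>

definition arr_poly ::
  "('k^'n) set set \<Rightarrow> (('k^'n) set \<Rightarrow> ('k::field_char_0, 'n::finite) mpoly) \<Rightarrow> ('k, 'n) mpoly" where
  "arr_poly A p = (\<Prod>H\<in>A. p H)"

definition arr_ops ::
  "('k^'n) set set \<Rightarrow> (('k^'n) set \<Rightarrow> ('k::field_char_0, 'n::finite) mpoly) \<Rightarrow> ('k, 'n) mop set" where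
  "arr_ops A p =
     {\<theta> \<in> weyl_algebra. \<theta> ` {arr_poly A p * f | f. True} \<subseteq> {arr_poly A p * f | f. True}}"

definition hom_arr_ops ::
  "nat \<Rightarrow> ('k^'n) set set \<Rightarrow> (('k^'n) set \<Rightarrow> ('k::field_char_0, 'n::finite) mpoly) \<Rightarrow> ('k, 'n) mop set" where
  "hom_arr_ops m A p = arr_ops A p \<inter> hom_ops m"

definition killing_derivation ::
  "(('k^'n) set \<Rightarrow> ('k::field_char_0, 'n::finite) mpoly) \<Rightarrow> ('k^'n) set set \<Rightarrow> ('k, 'n) mop \<Rightarrow> bool" where
  "killing_derivation p T \<delta> \<longleftrightarrow> \<delta> \<in> const_derivs \<and> \<delta> \<noteq> 0 \<and> (\<forall>H\<in>T. \<delta> (p H) = 0)"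

definition Xi_ops ::
  "nat \<Rightarrow> ('k^'n) set set \<Rightarrow> (('k^'n) set \<Rightarrow> ('k::field_char_0, 'n::finite) mpoly)
     \<Rightarrow> (nat \<Rightarrow> ('k^'n) set) \<Rightarrow> ('k, 'n) mop set" where
  "Xi_ops m A p Hs = {\<theta> \<in> hom_arr_ops m A p. \<theta> (\<Prod>i=1..m. p (Hs i)) = 0}"

definition Xi_gens ::
  "nat \<Rightarrow> ('k^'n) set set \<Rightarrow> (('k^'n) set \<Rightarrow> ('k::field_char_0, 'n::finite) mpoly)
     \<Rightarrow> (('k^'n) set set \<Rightarrow> ('k, 'n) mop) \<Rightarrow> (nat \<Rightarrow> ('k^'n) set) \<Rightarrow> ('k, 'n) mop set" where
  "Xi_gens m A p \<delta> Hs =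
     {op_scale (\<Prod>H\<in>A - T. p H) (\<delta> T ^^ m) | T.
        T \<in> k_subsets A (CARD('n) - 1) \<and> T \<inter> Hs ` {1..m} \<noteq> {}}"

definition internal_direct_sum ::
  "('k::field_char_0, 'n::finite) mop set \<Rightarrow> ('k, 'n) mop set \<Rightarrow> ('k, 'n) mop set \<Rightarrow> bool" where
  "internal_direct_sum M U V \<longleftrightarrow>
     ops.subspace U \<and> ops.subspace V \<and> M = {u + v | u v. u \<in> U \<and> v \<in> V} \<and> U \<inter> V = {0}"

definition minimal_generators ::
  "('k::field_char_0, 'n::finite) mop set \<Rightarrow> ('k, 'n) mop set \<Rightarrow> bool" where
  "minimal_generators G M \<longleftrightarrow> ops.span G = M \<and> (\<forall>G'. G' \<subset> G \<longrightarrow> ops.span G' \<noteq> M)"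

end

theory Submission
  imports Defs "HOL-Computational_Algebra.Polynomial"
begin

text \<open>
  Write \<open>a\<^sub>H\<close> for the coefficient vector of \<open>p\<^sub>H\<close>, and \<open>p\<^sub>R\<close> for the product of the \<open>p\<^sub>H\<close> with
  \<open>H \<in> R\<close>. An operator \<open>\<theta>\<close> that is homogeneous of order \<open>m\<close> is a symmetric \<open>m\<close>-tensor with polynomial
  coefficients, and \<open>\<Phi> R = \<theta> * p\<^sub>R\<close>, for \<open>R\<close> running over the \<open>m\<close>-subsets of \<open>A\<close>, is the table of its
  values on the \<open>a\<^sub>H\<close>. As \<open>A\<close> is generic and \<open>r \<ge> n + m - 1\<close>, this table determines \<open>\<theta>\<close>
  (\<open>generic_op_eq_0\<close>). If \<open>\<theta>\<close> preserves \<open>QS\<close>, then \<open>p\<^sub>R\<close> divides \<open>\<Phi> R\<close> (\<open>logarithmic_on_op\<close>). For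
  \<open>R\<^sub>0 = {H\<^sub>1,\<dots>,H\<^sub>m}\<close> the quotient \<open>\<Phi> R\<^sub>0 / p\<^bsub>R\<^sub>0\<^esub>\<close> is up to the factor \<open>m!\<close> the multiple of \<open>\<epsilon>\<^sub>m\<close>
  that has to be subtracted from \<open>\<theta>\<close> to reach \<open>\<Xi>\<close>, because \<open>\<epsilon>\<^sub>m\<close> maps \<open>p\<^bsub>R\<^sub>0\<^esub>\<close> to \<open>m! p\<^bsub>R\<^sub>0\<^esub>\<close>. This gives
  the first decomposition.

  That the operators \<open>P\<^sub>T \<delta>\<^sub>T\<^sup>m\<close> with \<open>T \<inter> R\<^sub>0 \<noteq> {}\<close> generate \<open>\<Xi>\<close> is a statement about tables
  (\<open>logarithmic_multilinear_generated\<close>), proved for the traces of the forms on a linear subspace \<open>W\<close>, by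
  induction on the number of forms. If there are exactly \<open>dim W + m - 1\<close> of them, then the products
  \<open>p\<^sub>R\<close> and the powers \<open>\<delta>\<^sub>T\<^sup>m\<close> are dual to each other up to scalars, \<open>R\<close> corresponding to \<open>T = A - R\<close>,
  and the expansion of the table can be read off (\<open>generated_boundary\<close>). Otherwise remove a form \<open>H\<close>
  outside \<open>R\<^sub>0\<close>. The table restricted to \<open>W \<inter> ker a\<^sub>H\<close> belongs to a generic arrangement of smaller dimension
  with fewer forms, so it is a combination of generators; these lift to generators on \<open>W\<close> attached to the
  sets \<open>T\<close> containing \<open>H\<close>. After their subtraction the table vanishes on \<open>W \<inter> ker a\<^sub>H\<close>, hence is divisible by
  \<open>a\<^sub>H\<close>, and the quotient is a table for \<open>A - {H}\<close>, to which the induction hypothesis applies again;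
  multiplying back by \<open>a\<^sub>H\<close> gives generators attached to sets \<open>T\<close> without \<open>H\<close>.

  Minimality: at the direction \<open>v\<^sub>T\<close> of \<open>\<delta>\<^sub>T\<close>, which spans the line \<open>\<Inter>T\<close>, every \<open>P\<^bsub>T'\<^esub>\<close> with \<open>T' \<noteq> T\<close>
  vanishes, but \<open>P\<^sub>T\<close> does not; so no generator lies in the span of the others.

  Since the field is infinite, polynomials are treated as functions on \<open>K\<^sup>n\<close> throughout the inductive part;
  restriction to a subspace is then just a restriction of the quantifiers.
\<close>

section \<open>Polynomial functions on linear subspaces\<close>

inductive polyfun :: "('k::field^'n::finite \<Rightarrow> 'k) \<Rightarrow> bool" where
  const: "polyfun (\<lambda>x. c)"
| coord: "polyfun (\<lambda>x. x $ i)"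
| add: "polyfun f \<Longrightarrow> polyfun g \<Longrightarrow> polyfun (\<lambda>x. f x + g x)"
| mult: "polyfun f \<Longrightarrow> polyfun g \<Longrightarrow> polyfun (\<lambda>x. f x * g x)"

lemma polyfun_sum:
  "(\<And>i. i \<in> I \<Longrightarrow> polyfun (f i)) \<Longrightarrow> polyfun (\<lambda>x. \<Sum>i\<in>I. f i x)"
  by (induction I rule: infinite_finite_induct) (auto intro: polyfun.intros)

lemma polyfun_prod:
  "(\<And>i. i \<in> I \<Longrightarrow> polyfun (f i)) \<Longrightarrow> polyfun (\<lambda>x. \<Prod>i\<in>I. f i x)"
  by (induction I rule: infinite_finite_induct) (auto intro: polyfun.intros)

lemma polyfun_power: "polyfun f \<Longrightarrow> polyfun (\<lambda>x. f x ^ k)"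
  by (induction k) (auto intro: polyfun.intros)

lemma polyfun_diff:
  assumes "polyfun f" "polyfun g"
  shows "polyfun (\<lambda>x. f x - g x)"
proof -
  have "polyfun (\<lambda>x. f x + (- 1) * g x)"
    by (intro polyfun.intros assms)
  then show ?thesis by simp
qed

definition dotp :: "'k::field^'n::finite \<Rightarrow> 'k^'n \<Rightarrow> 'k" where
  "dotp c x = (\<Sum>i\<in>UNIV. c $ i * x $ i)"

lemma dotp_add: "dotp c (x + y) = dotp c x + dotp c y"
  and dotp_scale: "dotp c (s *s x) = s * dotp c x"
  and dotp_diff: "dotp c (x - y) = dotp c x - dotp c y"
  and dotp_0: "dotp c 0 = 0"
  by (simp_all add: dotp_def algebra_simps sum.distrib sum_distrib_left sum_subtractf)

lemma polyfun_dotp: "polyfun (dotp c)"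
proof -
  have "polyfun (\<lambda>x. dotp c x)"
    unfolding dotp_def by (intro polyfun_sum polyfun.intros)
  then show ?thesis .
qed

lemmas polyfun_intros = polyfun.intros polyfun_sum polyfun_prod polyfun_power polyfun_diff polyfun_dotp

lemma polyfun_on_line:
  assumes "polyfun f"
  shows "\<exists>q. \<forall>t. f (u + t *s v) = poly q t"
  using assms
proof induction
  case (const c)
  have "\<forall>t. c = poly [:c:] t" by simp
  then show ?case by blast
next
  case (coord i)
  have "\<forall>t. (u + t *s v) $ i = poly [:u $ i, v $ i:] t" by simp
  then show ?case by blast
next
  case (add f g)
  then show ?case by (metis poly_add)
next
  case (mult f g)
  then show ?case by (metis poly_mult)
qed

text \<open>
  The coordinate ring of a subspace is a domain: on the line through a point with \<open>f \<noteq> 0\<close> and an arbitrary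
  point both functions are polynomials in one variable.
\<close>

lemma polyfun_mult_eq_0_on_subspace:
  fixes f g :: "'k::field_char_0^'n::finite \<Rightarrow> 'k"
  assumes "polyfun f" "polyfun g" "vec.subspace W"
    and fg: "\<And>x. x \<in> W \<Longrightarrow> f x * g x = 0"
    and u: "u \<in> W" "f u \<noteq> 0"
  shows "\<forall>x\<in>W. g x = 0"
proof
  fix w assume w: "w \<in> W"
  obtain q where q: "\<And>t. f (u + t *s (w - u)) = poly q t"
    using polyfun_on_line[OF assms(1)] by blast
  obtain q' where q': "\<And>t. g (u + t *s (w - u)) = poly q' t"
    using polyfun_on_line[OF assms(2)] by blast
  have "u + t *s (w - u) \<in> W" for t
    using u w assms(3) by (intro vec.subspace_add vec.subspace_scale vec.subspace_diff)
  then have "poly (q * q') t = 0" for t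
    using fg by (simp flip: q q')
  then have "q * q' = 0"
    using poly_all_0_iff_0 by blast
  moreover have "q \<noteq> 0"
    using q[of 0] u by auto
  ultimately show "g w = 0"
    using q'[of 1] by simp
qed

text \<open>
  This is the factor theorem for the substitution that moves \<open>x\<close> along \<open>w\<close>; if \<open>l\<close> is linear with \<open>l w = 1\<close>,
  this substitution is the projection onto the kernel of \<open>l\<close>.
\<close>

lemma polyfun_shift:
  assumes "polyfun f" "polyfun l"
  shows "\<exists>h. polyfun h \<and> (\<forall>x. f x - f (x - l x *s w) = l x * h x)"
  using assms(1)
proof induction
  case (const c)
  then show ?case by (intro exI[of _ "\<lambda>_. 0"]) (auto intro: polyfun.const)
next
  case (coord i)
  then show ?case by (intro exI[of _ "\<lambda>_. w $ i"]) (auto intro: polyfun.const)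
next
  case (add f g)
  then obtain h h' where h: "polyfun h" "polyfun h'"
    "\<And>x. f x - f (x - l x *s w) = l x * h x" "\<And>x. g x - g (x - l x *s w) = l x * h' x" by blast
  have "f x + g x - (f (x - l x *s w) + g (x - l x *s w)) = l x * (h x + h' x)" for x
    using arg_cong2[OF h(3)[of x] h(4)[of x], of "(+)"] by (simp add: algebra_simps)
  then show ?case
    using polyfun.add[OF h(1,2)] by blast
next
  case (mult f g)
  then obtain h h' where h: "polyfun h" "polyfun h'"
    "\<And>x. f x - f (x - l x *s w) = l x * h x" "\<And>x. g x - g (x - l x *s w) = l x * h' x" by blast
  have "f x * g x - f (x - l x *s w) * g (x - l x *s w) = l x * (h x * g x + (f x - l x * h x) * h' x)" for x
  proof -
    have e: "f (x - l x *s w) = f x - l x * h x" "g (x - l x *s w) = g x - l x * h' x"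
      using h(3)[of x] h(4)[of x] by (metis add_diff_cancel_left' diff_add_cancel)+
    show ?thesis unfolding e by (simp add: algebra_simps)
  qed
  moreover have "polyfun (\<lambda>x. h x * g x + (f x - l x * h x) * h' x)"
    by (intro polyfun_intros h mult assms)
  ultimately show ?case by blast
qed

lemma polyfun_factor_on_subspace:
  assumes "polyfun f" "vec.subspace W" "u \<in> W" "dotp c u \<noteq> 0"
    and "\<And>x. x \<in> W \<Longrightarrow> dotp c x = 0 \<Longrightarrow> f x = 0"
  shows "\<exists>h. polyfun h \<and> (\<forall>x\<in>W. f x = dotp c x * h x)"
proof -
  define w where "w = inverse (dotp c u) *s u"
  have w: "w \<in> W" "dotp c w = 1"
    using assms by (auto simp: w_def dotp_scale vec.subspace_scale)
  obtain h where h: "polyfun h" "\<And>x. f x - f (x - dotp c x *s w) = dotp c x * h x"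
    using polyfun_shift[OF assms(1) polyfun_dotp] by blast
  have "f x = dotp c x * h x" if "x \<in> W" for x
  proof -
    have "x - dotp c x *s w \<in> W"
      using that w assms(2) by (intro vec.subspace_scale vec.subspace_diff)
    then have "f (x - dotp c x *s w) = 0"
      using assms(5) w by (simp add: dotp_diff dotp_scale)
    then show ?thesis using h(2)[of x] by simp
  qed
  then show ?thesis using h by blast
qed

lemma subspace_ker: "vec.subspace W \<Longrightarrow> vec.subspace {x \<in> W. dotp c x = 0}"
  by (auto simp: vec.subspace_def dotp_add dotp_scale dotp_0)

text \<open>
  Subtracting from \<open>x\<close> the right multiple of \<open>u\<close> gives a point of the kernel of \<open>c\<close>.
\<close>

lemma form_combination:
  assumes "vec.subspace W" "dotp c u \<noteq> 0" "u \<in> W"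
    and "\<And>x. x \<in> W \<Longrightarrow> dotp c x = 0 \<Longrightarrow> dotp d x = 0" "x \<in> W"
  shows "dotp d x = dotp d u / dotp c u * dotp c x"
proof -
  define s where "s = dotp c x / dotp c u"
  have "x - s *s u \<in> W"
    using assms by (intro vec.subspace_scale vec.subspace_diff)
  moreover have "dotp c (x - s *s u) = 0"
    using assms(2) by (simp add: dotp_diff dotp_scale s_def)
  ultimately have "dotp d (x - s *s u) = 0"
    by (rule assms(4))
  then show ?thesis by (simp add: dotp_diff dotp_scale s_def mult.commute)
qed

lemma dotp_lincomb: "(\<Sum>K\<in>T. h K * dotp (a K) x) = dotp (\<Sum>K\<in>T. h K *s a K) x"
proof -
  have "(\<Sum>K\<in>T. h K * dotp (a K) x) = (\<Sum>K\<in>T. \<Sum>i\<in>UNIV. h K * (a K $ i * x $ i))"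
    by (simp add: dotp_def sum_distrib_left)
  also have "\<dots> = (\<Sum>i\<in>UNIV. \<Sum>K\<in>T. h K * (a K $ i * x $ i))"
    by (rule sum.swap)
  also have "\<dots> = dotp (\<Sum>K\<in>T. h K *s a K) x"
    by (simp add: dotp_def sum_distrib_right mult.assoc)
  finally show ?thesis .
qed

lemma dotp_diff_left: "dotp (c - d) x = dotp c x - dotp d x"
  by (simp add: dotp_def algebra_simps sum_subtractf)

text \<open>
  The annihilator duality of linear algebra. Intersecting \<open>W\<close> with one kernel after the other proves it
  without reference to dimensions.
\<close>

lemma form_in_span:
  assumes "finite T" "vec.subspace W"
    and "\<And>x. x \<in> W \<Longrightarrow> \<forall>K\<in>T. dotp (a K) x = 0 \<Longrightarrow> dotp d x = 0"
  shows "\<exists>h. \<forall>x\<in>W. dotp d x = (\<Sum>K\<in>T. h K * dotp (a K) x)"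
  using assms
proof (induction T arbitrary: W rule: finite_induct)
  case empty
  then show ?case by simp
next
  case (insert H T)
  let ?W' = "{x \<in> W. dotp (a H) x = 0}"
  have "\<exists>h. \<forall>x\<in>?W'. dotp d x = (\<Sum>K\<in>T. h K * dotp (a K) x)"
    by (rule insert.IH) (use insert.prems subspace_ker in auto)
  then obtain h where h: "\<And>x. x \<in> W \<Longrightarrow> dotp (a H) x = 0 \<Longrightarrow> dotp d x = (\<Sum>K\<in>T. h K * dotp (a K) x)"
    by auto
  let ?e = "d - (\<Sum>K\<in>T. h K *s a K)"
  have e: "dotp ?e x = dotp d x - (\<Sum>K\<in>T. h K * dotp (a K) x)" for x
    by (simp add: dotp_diff_left dotp_lincomb)
  have e0: "dotp ?e x = 0" if "x \<in> W" "dotp (a H) x = 0" for x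
    unfolding e using h[OF that] by simp
  have "\<exists>s. \<forall>x\<in>W. dotp ?e x = s * dotp (a H) x"
  proof (cases "\<exists>u\<in>W. dotp (a H) u \<noteq> 0")
    case True
    then obtain u where "u \<in> W" "dotp (a H) u \<noteq> 0" by blast
    then show ?thesis
      using form_combination[OF insert.prems(1) _ _ e0] by blast
  next
    case False
    then have "\<forall>x\<in>W. dotp ?e x = 0 * dotp (a H) x" using e0 by simp
    then show ?thesis by blast
  qed
  then obtain s where s: "\<And>x. x \<in> W \<Longrightarrow> dotp ?e x = s * dotp (a H) x" by blast
  have "dotp d x = (\<Sum>K\<in>insert H T. (h(H := s)) K * dotp (a K) x)" if "x \<in> W" for x
  proof -
    have "(\<Sum>K\<in>T. (h(H := s)) K * dotp (a K) x) = (\<Sum>K\<in>T. h K * dotp (a K) x)"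
      using insert.hyps by (intro sum.cong) auto
    moreover have "dotp d x = s * dotp (a H) x + (\<Sum>K\<in>T. h K * dotp (a K) x)"
      using s[OF that] unfolding e by (simp only: diff_eq_eq)
    ultimately show ?thesis
      using insert.hyps by simp
  qed
  then show ?case by blast
qed

lemma polyfun_prod_mult_eq_0_on_subspace:
  fixes h :: "'k::field_char_0^'n::finite \<Rightarrow> 'k"
  assumes "finite R" "vec.subspace W" "polyfun h"
    and "\<And>K. K \<in> R \<Longrightarrow> \<exists>u\<in>W. dotp (a K) u \<noteq> 0"
    and "\<And>x. x \<in> W \<Longrightarrow> (\<Prod>K\<in>R. dotp (a K) x) * h x = 0"
  shows "\<forall>x\<in>W. h x = 0"
  using assms(1,4,5)
proof (induction R rule: finite_induct)
  case empty
  then show ?case by simp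
next
  case (insert L R)
  obtain u where u: "u \<in> W" "dotp (a L) u \<noteq> 0" using insert.prems(1) by blast
  have "\<forall>x\<in>W. (\<Prod>K\<in>R. dotp (a K) x) * h x = 0"
    by (rule polyfun_mult_eq_0_on_subspace[OF polyfun_dotp _ assms(2) _ u])
      (use insert.hyps insert.prems(2) in \<open>auto intro!: polyfun_intros assms(3) simp: mult.assoc\<close>)
  then show ?case using insert.prems(1) by (intro insert.IH) auto
qed

text \<open>
  Forms that are pairwise non-proportional on \<open>W\<close> are pairwise coprime there: what is left after
  splitting off some of them still vanishes on the kernels of the others, as these kernels carry domains.
\<close>

lemma polyfun_factor_prod_on_subspace:
  fixes g :: "'k::field_char_0^'n::finite \<Rightarrow> 'k"
  assumes "finite R" "vec.subspace W" "polyfun g"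
    and "\<And>K. K \<in> R \<Longrightarrow> \<exists>u\<in>W. dotp (a K) u \<noteq> 0"
    and "\<And>K L. K \<in> R \<Longrightarrow> L \<in> R \<Longrightarrow> K \<noteq> L \<Longrightarrow> \<exists>u\<in>W. dotp (a L) u = 0 \<and> dotp (a K) u \<noteq> 0"
    and "\<And>K x. K \<in> R \<Longrightarrow> x \<in> W \<Longrightarrow> dotp (a K) x = 0 \<Longrightarrow> g x = 0"
  shows "\<exists>h. polyfun h \<and> (\<forall>x\<in>W. g x = (\<Prod>K\<in>R. dotp (a K) x) * h x)"
  using assms(1,4,5,6)
proof (induction R rule: finite_induct)
  case empty
  then show ?case using assms(3) by auto
next
  case (insert L R)
  have "\<exists>h. polyfun h \<and> (\<forall>x\<in>W. g x = (\<Prod>K\<in>R. dotp (a K) x) * h x)"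
    by (rule insert.IH) (use insert.prems in blast)+
  then obtain h where h: "polyfun h" "\<And>x. x \<in> W \<Longrightarrow> g x = (\<Prod>K\<in>R. dotp (a K) x) * h x"
    by blast
  let ?W = "{x \<in> W. dotp (a L) x = 0}"
  have "\<forall>x\<in>?W. h x = 0"
  proof (rule polyfun_prod_mult_eq_0_on_subspace[OF insert.hyps(1) subspace_ker[OF assms(2)] h(1)])
    fix K assume "K \<in> R"
    then show "\<exists>u\<in>?W. dotp (a K) u \<noteq> 0"
      using insert.prems(2)[of K L] insert.hyps(2) by auto
  next
    fix x assume "x \<in> ?W"
    then show "(\<Prod>K\<in>R. dotp (a K) x) * h x = 0"
      using h(2)[of x] insert.prems(3)[of L x] by simp
  qed
  moreover obtain u where "u \<in> W" "dotp (a L) u \<noteq> 0" using insert.prems(1) by blast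
  ultimately obtain h' where h': "polyfun h'" "\<And>x. x \<in> W \<Longrightarrow> h x = dotp (a L) x * h' x"
    using polyfun_factor_on_subspace[OF h(1) assms(2)] by blast
  have "g x = (\<Prod>K\<in>insert L R. dotp (a K) x) * h' x" if "x \<in> W" for x
    using insert.hyps h(2)[OF that] h'(2)[OF that] by (simp add: algebra_simps)
  then show ?case using h'(1) by blast
qed

section \<open>Tables of symmetric tensors on a generic arrangement\<close>

text \<open>
  The number \<open>n\<close> plays the role of the dimension of \<open>W\<close>. If \<open>A\<close> has at least \<open>n\<close> elements, the first
  condition bounds the dimension from above and states genericity; the second one, with a chosen
  nonzero vector \<open>v T\<close> on the line cut out by \<open>T\<close>, bounds it from below. This formulation passes directly to kernels (\<open>generic_on_restrict\<close>).
\<close>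

definition generic_on ::
  "('k::field_char_0^'n::finite) set \<Rightarrow> ('i \<Rightarrow> 'k^'n) \<Rightarrow> 'i set \<Rightarrow> nat \<Rightarrow> ('i set \<Rightarrow> 'k^'n) \<Rightarrow> bool" where
  "generic_on W a A n v \<longleftrightarrow> vec.subspace W \<and> finite A \<and>
     (\<forall>T x. T \<subseteq> A \<longrightarrow> card T = n \<longrightarrow> x \<in> W \<longrightarrow> (\<forall>K\<in>T. dotp (a K) x = 0) \<longrightarrow> x = 0) \<and>
     (\<forall>T. T \<subseteq> A \<longrightarrow> Suc (card T) = n \<longrightarrow> v T \<in> W \<and> v T \<noteq> 0 \<and> (\<forall>K\<in>T. dotp (a K) (v T) = 0))"

text \<open>
  The table of values \<open>\<Phi> R\<close> of a symmetric \<open>m\<close>-linear map on \<open>m\<close>-tuples of distinct forms respects every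
  linear relation, on \<open>W\<close>, in one argument \<open>K\<close> while the others, \<open>U\<close>, are fixed.
\<close>

definition multilinear_on ::
  "nat \<Rightarrow> ('k::field_char_0^'n::finite) set \<Rightarrow> ('i \<Rightarrow> 'k^'n) \<Rightarrow> 'i set \<Rightarrow> ('i set \<Rightarrow> 'k^'n \<Rightarrow> 'k) \<Rightarrow> bool" where
  "multilinear_on m W a A \<Phi> \<longleftrightarrow>
     (\<forall>U h. U \<subseteq> A \<longrightarrow> Suc (card U) = m \<longrightarrow> (\<forall>x\<in>W. (\<Sum>K\<in>A - U. h K * dotp (a K) x) = 0) \<longrightarrow>
        (\<forall>x\<in>W. (\<Sum>K\<in>A - U. h K * \<Phi> (insert K U) x) = 0))"

definition logarithmic_on ::
  "nat \<Rightarrow> ('k::field_char_0^'n::finite) set \<Rightarrow> ('i \<Rightarrow> 'k^'n) \<Rightarrow> 'i set \<Rightarrow> ('i set \<Rightarrow> 'k^'n \<Rightarrow> 'k) \<Rightarrow> bool" where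
  "logarithmic_on m W a A \<Phi> \<longleftrightarrow>
     (\<forall>R. R \<subseteq> A \<longrightarrow> card R = m \<longrightarrow>
        (\<exists>f. polyfun f \<and> (\<forall>x\<in>W. \<Phi> R x = (\<Prod>K\<in>R. dotp (a K) x) * f x)))"

text \<open>
  Up to the factor \<open>m!\<close>, this is the value at \<open>x\<close> of \<open>P\<^sub>T \<delta>\<^sup>m\<close> on the product of the forms in \<open>R\<close>, where \<open>\<delta>\<close>
  is the derivative in direction \<open>w\<close>.
\<close>

definition generator ::
  "('i \<Rightarrow> 'k::field_char_0^'n::finite) \<Rightarrow> 'i set \<Rightarrow> 'i set \<Rightarrow> 'k^'n \<Rightarrow> 'i set \<Rightarrow> 'k^'n \<Rightarrow> 'k" where
  "generator a A T w R x = (\<Prod>K\<in>A - T. dotp (a K) x) * (\<Prod>K\<in>R. dotp (a K) w)"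

lemma polyfun_generator: "polyfun (generator a A T w R)"
proof -
  have "polyfun (\<lambda>x. generator a A T w R x)"
    unfolding generator_def by (intro polyfun_intros)
  then show ?thesis .
qed

lemma generator_eq_0:
  "finite R \<Longrightarrow> K \<in> R \<Longrightarrow> dotp (a K) w = 0 \<Longrightarrow> generator a A T w R x = 0"
  unfolding generator_def by auto

lemma multilinear_on_sum:
  assumes "finite I" "\<And>i. i \<in> I \<Longrightarrow> multilinear_on m W a A (\<Phi> i)"
  shows "multilinear_on m W a A (\<lambda>R x. \<Sum>i\<in>I. \<Phi> i R x)"
  unfolding multilinear_on_def
proof (intro allI impI ballI)
  fix U h x
  assume U: "U \<subseteq> A" "Suc (card U) = m" "\<forall>x\<in>W. (\<Sum>K\<in>A - U. h K * dotp (a K) x) = 0" "x \<in> W"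
  have "(\<Sum>K\<in>A - U. h K * (\<Sum>i\<in>I. \<Phi> i (insert K U) x)) =
      (\<Sum>i\<in>I. \<Sum>K\<in>A - U. h K * \<Phi> i (insert K U) x)"
    by (simp add: sum_distrib_left sum.swap[of _ I])
  also have "\<dots> = 0"
    using assms(2) U unfolding multilinear_on_def by (intro sum.neutral) blast
  finally show "(\<Sum>K\<in>A - U. h K * (\<Sum>i\<in>I. \<Phi> i (insert K U) x)) = 0" .
qed

lemma multilinear_on_diff:
  assumes "multilinear_on m W a A \<Phi>" "multilinear_on m W a A \<Psi>"
  shows "multilinear_on m W a A (\<lambda>R x. \<Phi> R x - \<Psi> R x)"
  using assms unfolding multilinear_on_def by (simp add: right_diff_distrib sum_subtractf)

lemma multilinear_on_generator:
  assumes "finite A" "w \<in> W"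
  shows "multilinear_on m W a A (\<lambda>R x. s x * generator a A T w R x)"
  unfolding multilinear_on_def
proof (intro allI impI ballI)
  fix U h x
  assume U: "U \<subseteq> A" "\<forall>x\<in>W. (\<Sum>K\<in>A - U. h K * dotp (a K) x) = 0"
  have "finite U" using U(1) assms(1) finite_subset by blast
  then have "(\<Sum>K\<in>A - U. h K * (s x * generator a A T w (insert K U) x)) =
      (\<Sum>K\<in>A - U. s x * (\<Prod>K\<in>A - T. dotp (a K) x) * (\<Prod>K\<in>U. dotp (a K) w) * (h K * dotp (a K) w))"
    by (intro sum.cong) (auto simp: generator_def algebra_simps)
  also have "\<dots> = s x * (\<Prod>K\<in>A - T. dotp (a K) x) * (\<Prod>K\<in>U. dotp (a K) w) * (\<Sum>K\<in>A - U. h K * dotp (a K) w)"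
    by (simp add: sum_distrib_left)
  also have "\<dots> = 0" using U(2) assms(2) by simp
  finally show "(\<Sum>K\<in>A - U. h K * (s x * generator a A T w (insert K U) x)) = 0" .
qed

lemma multilinear_on_remove:
  assumes "finite A" "H \<in> A" "multilinear_on m W a A \<Phi>"
  shows "multilinear_on m W a (A - {H}) \<Phi>"
  unfolding multilinear_on_def
proof (intro allI impI)
  fix U h
  assume U: "U \<subseteq> A - {H}" "Suc (card U) = m" "\<forall>x\<in>W. (\<Sum>K\<in>A - {H} - U. h K * dotp (a K) x) = 0"
  have eq: "(\<Sum>K\<in>A - U. (h(H := 0)) K * F K) = (\<Sum>K\<in>A - {H} - U. h K * F K)" for F
    by (rule sum.mono_neutral_cong_right) (use assms(1) in auto)
  have "\<forall>x\<in>W. (\<Sum>K\<in>A - U. (h(H := 0)) K * \<Phi> (insert K U) x) = 0"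
    using assms(3) U unfolding multilinear_on_def eq[symmetric] by blast
  then show "\<forall>x\<in>W. (\<Sum>K\<in>A - {H} - U. h K * \<Phi> (insert K U) x) = 0"
    by (simp only: eq)
qed

lemma logarithmic_on_subset:
  assumes "logarithmic_on m W a A \<Phi>" "B \<subseteq> A" "V \<subseteq> W"
  shows "logarithmic_on m V a B \<Phi>"
  unfolding logarithmic_on_def
proof (intro allI impI)
  fix R assume "R \<subseteq> B" "card R = m"
  then have "R \<subseteq> A" "card R = m" using assms(2) by auto
  then obtain f where "polyfun f" "\<forall>x\<in>W. \<Phi> R x = (\<Prod>K\<in>R. dotp (a K) x) * f x"
    using assms(1) unfolding logarithmic_on_def by blast
  then show "\<exists>f. polyfun f \<and> (\<forall>x\<in>V. \<Phi> R x = (\<Prod>K\<in>R. dotp (a K) x) * f x)"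
    using assms(3) by (intro exI[of _ f]) auto
qed

lemma generic_on_remove:
  "generic_on W a A n v \<Longrightarrow> generic_on W a (A - {H}) n v"
  unfolding generic_on_def by blast

lemma generic_on_restrict:
  assumes "generic_on W a A (Suc n) v" "H \<in> A"
  shows "generic_on {x \<in> W. dotp (a H) x = 0} a (A - {H}) n (\<lambda>T. v (insert H T))"
proof -
  have fin: "finite T" if "T \<subseteq> A - {H}" for T
    using assms that unfolding generic_on_def by (meson finite_Diff finite_subset)
  have card: "card (insert H T) = Suc (card T)" if "T \<subseteq> A - {H}" for T
    using fin[OF that] that by (simp add: subset_Diff_insert)
  show ?thesis
    unfolding generic_on_def
  proof (intro conjI allI impI)
    show "vec.subspace {x \<in> W. dotp (a H) x = 0}"
      using assms subspace_ker unfolding generic_on_def by blast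
    show "finite (A - {H})" using assms unfolding generic_on_def by blast
  next
    fix T x
    assume T: "T \<subseteq> A - {H}" "card T = n" "x \<in> {x \<in> W. dotp (a H) x = 0}" "\<forall>K\<in>T. dotp (a K) x = 0"
    then have "insert H T \<subseteq> A" "card (insert H T) = Suc n" "\<forall>K\<in>insert H T. dotp (a K) x = 0"
      using assms(2) card by auto
    then show "x = 0" using assms(1) T(3) unfolding generic_on_def by blast
  next
    fix T
    assume T: "T \<subseteq> A - {H}" "Suc (card T) = n"
    then have *: "insert H T \<subseteq> A" "Suc (card (insert H T)) = Suc n"
      using assms(2) card by auto
    then have "v (insert H T) \<in> W \<and> v (insert H T) \<noteq> 0 \<and> (\<forall>K\<in>insert H T. dotp (a K) (v (insert H T)) = 0)"
      using assms(1) unfolding generic_on_def by blast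
    then show "v (insert H T) \<in> {x \<in> W. dotp (a H) x = 0}" "v (insert H T) \<noteq> 0"
      "\<forall>K\<in>T. dotp (a K) (v (insert H T)) = 0"
      by auto
  qed
qed

lemma generic_on_witness:
  assumes "generic_on W a A n v" "T \<subseteq> A" "Suc (card T) = n"
  shows "v T \<in> W \<and> v T \<noteq> 0 \<and> (\<forall>K\<in>T. dotp (a K) (v T) = 0)"
  using assms unfolding generic_on_def by blast

lemma generic_on_form_neq_0:
  assumes "generic_on W a A n v" "T \<subseteq> A" "Suc (card T) = n" "K \<in> A - T"
  shows "dotp (a K) (v T) \<noteq> 0"
proof
  assume "dotp (a K) (v T) = 0"
  moreover have "finite T" using assms unfolding generic_on_def by (meson finite_subset)
  ultimately have "insert K T \<subseteq> A" "card (insert K T) = n" "\<forall>L\<in>insert K T. dotp (a L) (v T) = 0" "v T \<in> W" "v T \<noteq> 0"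
    using assms(2-4) assms(1)[unfolded generic_on_def] by auto
  then show False using assms(1) unfolding generic_on_def by blast
qed

lemma generic_on_ex_neq_0:
  assumes "generic_on W a A n v" "1 \<le> n" "n \<le> card A" "K \<in> A"
  shows "\<exists>u\<in>W. dotp (a K) u \<noteq> 0"
proof -
  have "finite A" using assms unfolding generic_on_def by blast
  then have "n - 1 \<le> card (A - {K})" using assms by simp
  then obtain T where T: "T \<subseteq> A - {K}" "card T = n - 1" by (meson obtain_subset_with_card_n)
  then have TA: "T \<subseteq> A" "Suc (card T) = n" "K \<in> A - T"
    using assms(2,4) by auto
  then have "dotp (a K) (v T) \<noteq> 0" "v T \<in> W"
    using generic_on_form_neq_0[OF assms(1) TA] generic_on_witness[OF assms(1) TA(1,2)] by auto
  then show ?thesis by blast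
qed

lemma generic_on_ex_separating:
  assumes "generic_on W a A n v" "2 \<le> n" "n \<le> card A" "K \<in> A" "L \<in> A" "K \<noteq> L"
  shows "\<exists>u\<in>W. dotp (a L) u = 0 \<and> dotp (a K) u \<noteq> 0"
proof -
  obtain n' where n': "n = Suc n'" using assms(2) by (cases n) auto
  have "finite A" using assms unfolding generic_on_def by blast
  then have "n' \<le> card (A - {L})" using assms n' by simp
  then show ?thesis
    using generic_on_ex_neq_0[OF generic_on_restrict[of W a A n' v L], of K] assms n' by auto
qed

text \<open>
  A set \<open>R\<close> containing \<open>H\<close> leaves at least \<open>n\<close> forms outside, and these span all forms on \<open>W\<close>. Writing
  \<open>a\<^sub>H\<close> in terms of them reduces \<open>\<Phi> R\<close> to values on sets without \<open>H\<close>.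
\<close>

lemma multilinear_on_eq_0_extend:
  assumes gen: "generic_on W a A n v" and "H \<in> A" and card: "n + m \<le> card A" and "1 \<le> m"
    and mult: "multilinear_on m W a A \<Phi>"
    and zero: "\<And>R x. R \<subseteq> A - {H} \<Longrightarrow> card R = m \<Longrightarrow> x \<in> W \<Longrightarrow> \<Phi> R x = 0"
    and R: "R \<subseteq> A" "card R = m" and x: "x \<in> W"
  shows "\<Phi> R x = 0"
proof (cases "H \<in> R")
  case False
  then show ?thesis using zero R x by blast
next
  case True
  have fin: "finite A" "finite R" using gen R unfolding generic_on_def by (auto intro: finite_subset)
  define U where "U = R - {H}"
  have U: "U \<subseteq> A" "Suc (card U) = m" "insert H U = R" "H \<notin> U" "finite U"
    using True R fin assms(4) by (auto simp: U_def)
  have "\<exists>h. \<forall>x\<in>W. dotp (a H) x = (\<Sum>K\<in>A - R. h K * dotp (a K) x)"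
  proof (rule form_in_span)
    fix x assume x: "x \<in> W" "\<forall>K\<in>A - R. dotp (a K) x = 0"
    have "n \<le> card (A - R)" using card R fin by (simp add: card_Diff_subset)
    then obtain T where "T \<subseteq> A - R" "card T = n" by (meson obtain_subset_with_card_n)
    then have "x = 0" using gen x unfolding generic_on_def by blast
    then show "dotp (a H) x = 0" by (simp add: dotp_0)
  qed (use gen fin in \<open>auto simp: generic_on_def\<close>)
  then obtain h where h: "\<And>x. x \<in> W \<Longrightarrow> dotp (a H) x = (\<Sum>K\<in>A - R. h K * dotp (a K) x)" by blast
  define h' where "h' = h(H := - 1)"
  have split: "(\<Sum>K\<in>A - U. h' K * F K) = (\<Sum>K\<in>A - R. h K * F K) - F H" for F :: "_ \<Rightarrow> 'a"
  proof -
    have "A - U = insert H (A - R)" using U True \<open>H \<in> A\<close> by auto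
    moreover have "(\<Sum>K\<in>A - R. h' K * F K) = (\<Sum>K\<in>A - R. h K * F K)"
      using True by (intro sum.cong) (auto simp: h'_def)
    ultimately show ?thesis using fin True by (simp add: h'_def)
  qed
  have "\<forall>x\<in>W. (\<Sum>K\<in>A - U. h' K * dotp (a K) x) = 0"
    using h by (simp add: split)
  then have "(\<Sum>K\<in>A - U. h' K * \<Phi> (insert K U) x) = 0"
    using mult U x unfolding multilinear_on_def by blast
  moreover have "(\<Sum>K\<in>A - R. h K * \<Phi> (insert K U) x) = 0"
  proof (intro sum.neutral ballI)
    fix K assume K: "K \<in> A - R"
    then have "insert K U \<subseteq> A - {H}" "card (insert K U) = m"
      using U True by auto
    then show "h K * \<Phi> (insert K U) x = 0" using zero x by simp
  qed
  ultimately show ?thesis using U(3) by (simp add: split)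
qed

section \<open>Generation by powers of derivations\<close>

definition meeting_sets :: "'i set \<Rightarrow> nat \<Rightarrow> 'i set \<Rightarrow> 'i set set" where
  "meeting_sets A n R = {T. T \<subseteq> A \<and> Suc (card T) = n \<and> T \<inter> R \<noteq> {}}"

lemma finite_meeting_sets: "finite A \<Longrightarrow> finite (meeting_sets A n R)"
  unfolding meeting_sets_def by (rule finite_subset[of _ "Pow A"]) auto

lemma meeting_sets_remove:
  assumes "finite A" "H \<in> A" "H \<notin> R"
  shows "meeting_sets A (Suc n) R =
    meeting_sets (A - {H}) (Suc n) R \<union> insert H ` meeting_sets (A - {H}) n R"
    (is "?L = ?B \<union> insert H ` ?C")
proof (intro equalityI subsetI)
  fix T assume T: "T \<in> ?L"
  show "T \<in> ?B \<union> insert H ` ?C"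
  proof (cases "H \<in> T")
    case True
    have "finite T" using T assms(1) finite_subset unfolding meeting_sets_def by blast
    then have "T - {H} \<in> ?C" "T = insert H (T - {H})"
      using T True assms(3) card_Suc_Diff1[of T H] unfolding meeting_sets_def by auto
    then show ?thesis by blast
  next
    case False
    then show ?thesis using T unfolding meeting_sets_def by auto
  qed
next
  fix T assume T: "T \<in> ?B \<union> insert H ` ?C"
  then consider "T \<in> ?B" | T' where "T' \<in> ?C" "T = insert H T'" by auto
  then show "T \<in> ?L"
  proof cases
    case 1
    then show ?thesis unfolding meeting_sets_def by auto
  next
    case 2
    moreover from 2 have "finite T'" using assms(1) unfolding meeting_sets_def by (auto intro: finite_subset)
    ultimately show ?thesis using assms unfolding meeting_sets_def by (auto simp: card_insert_if)
  qed
qed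

text \<open>
  Here \<open>T \<mapsto> A - T\<close> is a bijection from the \<open>(n - 1)\<close>-subsets to the \<open>m\<close>-subsets, and the generator of \<open>T\<close>
  vanishes on all \<open>R\<close> except \<open>A - T\<close>, since every other \<open>R\<close> meets \<open>T\<close>. So the coefficient of \<open>T\<close> is a
  normalized quotient \<open>\<Phi> (A - T) / p\<^bsub>A - T\<^esub>\<close>; the only \<open>T\<close> that does not meet \<open>R0\<close> is \<open>A - R0\<close>, with
  coefficient zero.
\<close>

lemma generated_boundary:
  assumes gen: "generic_on W a A n v" and card: "n + m = Suc (card A)" and "1 \<le> n"
    and log: "logarithmic_on m W a A \<Phi>"
    and R0: "R0 \<subseteq> A" "card R0 = m" "\<And>x. x \<in> W \<Longrightarrow> \<Phi> R0 x = 0"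
  shows "\<exists>g. (\<forall>T. polyfun (g T)) \<and> (\<forall>R. R \<subseteq> A \<longrightarrow> card R = m \<longrightarrow> (\<forall>x\<in>W.
           \<Phi> R x = (\<Sum>T\<in>meeting_sets A n R0. g T x * generator a A T (v T) R x)))"
proof -
  have fin: "finite A" using gen unfolding generic_on_def by blast
  obtain f where f: "\<And>R. R \<subseteq> A \<Longrightarrow> card R = m \<Longrightarrow> polyfun (f R)"
    "\<And>R x. R \<subseteq> A \<Longrightarrow> card R = m \<Longrightarrow> x \<in> W \<Longrightarrow> \<Phi> R x = (\<Prod>K\<in>R. dotp (a K) x) * f R x"
    using log unfolding logarithmic_on_def by metis
  define g where "g T x = (if T \<subseteq> A \<and> Suc (card T) = n
      then f (A - T) x * inverse (\<Prod>K\<in>A - T. dotp (a K) (v T)) else 0)" for T x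
  have "polyfun (g T)" for T
  proof (cases "T \<subseteq> A \<and> Suc (card T) = n")
    case True
    then have "card (A - T) = m" using card fin by (auto simp: card_Diff_subset finite_subset)
    then have "polyfun (\<lambda>x. f (A - T) x * inverse (\<Prod>K\<in>A - T. dotp (a K) (v T)))"
      by (intro polyfun_intros f) auto
    then show ?thesis using True by (simp add: g_def[abs_def])
  next
    case False
    then show ?thesis by (simp only: g_def[abs_def] if_False polyfun.const)
  qed
  moreover have "\<Phi> R x = (\<Sum>T\<in>meeting_sets A n R0. g T x * generator a A T (v T) R x)"
    if R: "R \<subseteq> A" "card R = m" and x: "x \<in> W" for R x
  proof -
    have finR: "finite R" using R fin finite_subset by blast
    have 0: "generator a A T (v T) R x = 0" if T: "T \<in> meeting_sets A n R0" "T \<noteq> A - R" for T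
    proof -
      have T': "T \<subseteq> A" "Suc (card T) = n" using T unfolding meeting_sets_def by auto
      have "card (A - R) = card T" using R card finR T' by (simp add: card_Diff_subset)
      then have "\<not> T \<subseteq> A - R" using T fin by (metis card_subset_eq finite_Diff)
      then obtain K where "K \<in> T" "K \<in> R" using T' by auto
      then show ?thesis
        using gen T' finR unfolding generic_on_def by (intro generator_eq_0[of R K]) auto
    qed
    show ?thesis
    proof (cases "A - R \<in> meeting_sets A n R0")
      case True
      then have T: "A - R \<subseteq> A" "Suc (card (A - R)) = n" unfolding meeting_sets_def by auto
      have AR: "A - (A - R) = R" using R by blast
      have "(\<Sum>T\<in>meeting_sets A n R0. g T x * generator a A T (v T) R x) =
          (\<Sum>T\<in>{A - R}. g T x * generator a A T (v T) R x)"
        using True 0 fin by (intro sum.mono_neutral_right) (auto simp: finite_meeting_sets)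
      also have "\<dots> = f R x * inverse (\<Prod>K\<in>R. dotp (a K) (v (A - R))) *
          ((\<Prod>K\<in>R. dotp (a K) x) * (\<Prod>K\<in>R. dotp (a K) (v (A - R))))"
        using T AR by (simp add: g_def generator_def)
      also have "\<dots> = (\<Prod>K\<in>R. dotp (a K) x) * f R x"
      proof -
        have "(\<Prod>K\<in>R. dotp (a K) (v (A - R))) \<noteq> 0"
          using generic_on_form_neq_0[OF gen T] R finR by auto
        then show ?thesis by simp
      qed
      finally show ?thesis using f(2)[OF R x] by simp
    next
      case False
      have "Suc (card (A - R)) = n" using card R finR assms(3) by (simp add: card_Diff_subset)
      then have "R0 \<subseteq> R" using False R0(1) unfolding meeting_sets_def by auto
      then have "R0 = R" using R0(2) R finR by (simp add: card_subset_eq)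
      then have "\<Phi> R x = 0" using R0(3) x by simp
      moreover have "(\<Sum>T\<in>meeting_sets A n R0. g T x * generator a A T (v T) R x) = 0"
      proof (intro sum.neutral ballI)
        fix T assume "T \<in> meeting_sets A n R0"
        moreover from this have "T \<noteq> A - R" using False by blast
        ultimately show "g T x * generator a A T (v T) R x = 0" using 0 by simp
      qed
      ultimately show ?thesis by simp
    qed
  qed
  ultimately show ?thesis by blast
qed

text \<open>
  A linear relation on the kernel of \<open>a\<^sub>H\<close> is on \<open>W\<close> a relation that also involves \<open>a\<^sub>H\<close>; the additional
  term \<open>\<Phi> (insert H U)\<close> is divisible by \<open>a\<^sub>H\<close> and disappears on the kernel.
\<close>

lemma multilinear_on_restrict:
  assumes "finite A" "vec.subspace W" "H \<in> A" "u \<in> W" "dotp (a H) u \<noteq> 0"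
    and mult: "multilinear_on m W a A \<Phi>" and log: "logarithmic_on m W a A \<Phi>"
  shows "multilinear_on m {x \<in> W. dotp (a H) x = 0} a (A - {H}) \<Phi>"
  unfolding multilinear_on_def
proof (intro allI impI)
  fix U h
  assume U: "U \<subseteq> A - {H}" "Suc (card U) = m"
    and h: "\<forall>x\<in>{x \<in> W. dotp (a H) x = 0}. (\<Sum>K\<in>A - {H} - U. h K * dotp (a K) x) = 0"
  have finU: "finite U" using U(1) assms(1) by (auto intro: finite_subset)
  define d where "d = (\<Sum>K\<in>A - {H} - U. h K *s a K)"
  define s where "s = dotp d u / dotp (a H) u"
  have d: "dotp d x = (\<Sum>K\<in>A - {H} - U. h K * dotp (a K) x)" for x
    by (simp add: d_def dotp_lincomb)
  have ds: "dotp d x = s * dotp (a H) x" if "x \<in> W" for x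
    unfolding s_def using that h d assms(2,4,5) by (intro form_combination) auto
  have split: "(\<Sum>K\<in>A - U. (h(H := - s)) K * F K) = (\<Sum>K\<in>A - {H} - U. h K * F K) - s * F H" for F
  proof -
    have "A - U = insert H (A - {H} - U)" using U assms(3) by auto
    moreover have "(\<Sum>K\<in>A - {H} - U. (h(H := - s)) K * F K) = (\<Sum>K\<in>A - {H} - U. h K * F K)"
      by (intro sum.cong) auto
    ultimately show ?thesis using assms(1) by simp
  qed
  have "\<forall>x\<in>W. (\<Sum>K\<in>A - U. (h(H := - s)) K * dotp (a K) x) = 0"
    unfolding split using ds d by simp
  then have *: "\<forall>x\<in>W. (\<Sum>K\<in>A - U. (h(H := - s)) K * \<Phi> (insert K U) x) = 0"
    using mult U unfolding multilinear_on_def by blast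
  show "\<forall>x\<in>{x \<in> W. dotp (a H) x = 0}. (\<Sum>K\<in>A - {H} - U. h K * \<Phi> (insert K U) x) = 0"
  proof
    fix x assume x: "x \<in> {x \<in> W. dotp (a H) x = 0}"
    have "H \<notin> U" using U(1) by blast
    then have "insert H U \<subseteq> A" "card (insert H U) = m" using U assms(3) finU by auto
    then obtain f where "\<forall>x\<in>W. \<Phi> (insert H U) x = (\<Prod>K\<in>insert H U. dotp (a K) x) * f x"
      using log unfolding logarithmic_on_def by blast
    then have "\<Phi> (insert H U) x = 0" using x finU U by auto
    moreover have "(\<Sum>K\<in>A - {H} - U. h K * \<Phi> (insert K U) x) - s * \<Phi> (insert H U) x = 0"
      using * x unfolding split by blast
    ultimately show "(\<Sum>K\<in>A - {H} - U. h K * \<Phi> (insert K U) x) = 0" by simp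
  qed
qed

lemma multilinear_on_cancel:
  assumes "vec.subspace W" "u \<in> W" "dotp c u \<noteq> 0" "finite A"
    and mult: "multilinear_on m W a A \<Psi>"
    and G: "\<And>R. R \<subseteq> A \<Longrightarrow> card R = m \<Longrightarrow> polyfun (G R)"
      "\<And>R x. R \<subseteq> A \<Longrightarrow> card R = m \<Longrightarrow> x \<in> W \<Longrightarrow> \<Psi> R x = dotp c x * G R x"
  shows "multilinear_on m W a A G"
  unfolding multilinear_on_def
proof (intro allI impI)
  fix U h
  assume U: "U \<subseteq> A" "Suc (card U) = m" "\<forall>x\<in>W. (\<Sum>K\<in>A - U. h K * dotp (a K) x) = 0"
  have finU: "finite U" using U(1) assms(4) by (auto intro: finite_subset)
  have ins: "insert K U \<subseteq> A" "card (insert K U) = m" if "K \<in> A - U" for K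
    using that U finU by auto
  show "\<forall>x\<in>W. (\<Sum>K\<in>A - U. h K * G (insert K U) x) = 0"
  proof (rule polyfun_mult_eq_0_on_subspace[OF polyfun_dotp _ assms(1) _ assms(2,3)])
    show "polyfun (\<lambda>x. \<Sum>K\<in>A - U. h K * G (insert K U) x)"
      using ins by (intro polyfun_intros G)
  next
    fix x assume x: "x \<in> W"
    have "dotp c x * (\<Sum>K\<in>A - U. h K * G (insert K U) x) = (\<Sum>K\<in>A - U. h K * \<Psi> (insert K U) x)"
      unfolding sum_distrib_left by (intro sum.cong) (use ins G(2) x in \<open>auto simp: algebra_simps\<close>)
    also have "\<dots> = 0" using mult U x unfolding multilinear_on_def by blast
    finally show "dotp c x * (\<Sum>K\<in>A - U. h K * G (insert K U) x) = 0" .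
  qed
qed

text \<open>
  Either \<open>R\<close> meets \<open>T\<close> and the value is zero, or \<open>R \<subseteq> A - T\<close> and the product over \<open>A - T\<close> contains the one
  over \<open>R\<close>.
\<close>

lemma logarithmic_on_generator:
  assumes "finite A" "T \<subseteq> A" "\<And>K. K \<in> T \<Longrightarrow> dotp (a K) w = 0" "polyfun s"
  shows "logarithmic_on m W a A (\<lambda>R x. s x * generator a A T w R x)"
  unfolding logarithmic_on_def
proof (intro allI impI)
  fix R assume R: "R \<subseteq> A" "card R = m"
  have finR: "finite R" using R assms(1) finite_subset by blast
  show "\<exists>f. polyfun f \<and> (\<forall>x\<in>W. s x * generator a A T w R x = (\<Prod>K\<in>R. dotp (a K) x) * f x)"
  proof (cases "R \<inter> T = {}")
    case True
    then have "A - T = R \<union> (A - T - R)" using R by blast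
    then have "(\<Prod>K\<in>A - T. dotp (a K) x) = (\<Prod>K\<in>R. dotp (a K) x) * (\<Prod>K\<in>A - T - R. dotp (a K) x)" for x
      using assms(1) finR by (metis prod.union_disjoint finite_Diff Diff_disjoint)
    then have "s x * generator a A T w R x =
      (\<Prod>K\<in>R. dotp (a K) x) * (s x * (\<Prod>K\<in>A - T - R. dotp (a K) x) * (\<Prod>K\<in>R. dotp (a K) w))" for x
      by (simp add: generator_def algebra_simps)
    moreover have "polyfun (\<lambda>x. s x * (\<Prod>K\<in>A - T - R. dotp (a K) x) * (\<Prod>K\<in>R. dotp (a K) w))"
      by (intro polyfun_intros assms)
    ultimately show ?thesis by blast
  next
    case False
    then obtain K where K: "K \<in> R" "K \<in> T" by blast
    have "generator a A T w R x = 0" for x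
      using assms(3)[OF K(2)] by (intro generator_eq_0[where K = K] finR K)
    then show ?thesis by (intro exI[of _ "\<lambda>_. 0"]) (auto intro: polyfun.const)
  qed
qed

lemma logarithmic_on_diff:
  assumes "logarithmic_on m W a A \<Phi>" "logarithmic_on m W a A \<Psi>"
  shows "logarithmic_on m W a A (\<lambda>R x. \<Phi> R x - \<Psi> R x)"
  unfolding logarithmic_on_def
proof (intro allI impI)
  fix R assume R: "R \<subseteq> A" "card R = m"
  obtain f where "polyfun f" "\<forall>x\<in>W. \<Phi> R x = (\<Prod>K\<in>R. dotp (a K) x) * f x"
    using assms(1) R unfolding logarithmic_on_def by blast
  moreover obtain g where "polyfun g" "\<forall>x\<in>W. \<Psi> R x = (\<Prod>K\<in>R. dotp (a K) x) * g x"
    using assms(2) R unfolding logarithmic_on_def by blast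
  ultimately show "\<exists>f. polyfun f \<and> (\<forall>x\<in>W. \<Phi> R x - \<Psi> R x = (\<Prod>K\<in>R. dotp (a K) x) * f x)"
    by (intro exI[of _ "\<lambda>x. f x - g x"] conjI polyfun_diff) (auto simp: algebra_simps)
qed

lemma logarithmic_on_sum:
  assumes "\<And>i. i \<in> I \<Longrightarrow> logarithmic_on m W a A (\<Phi> i)"
  shows "logarithmic_on m W a A (\<lambda>R x. \<Sum>i\<in>I. \<Phi> i R x)"
  unfolding logarithmic_on_def
proof (intro allI impI)
  fix R assume "R \<subseteq> A" "card R = m"
  then have "\<forall>i\<in>I. \<exists>f. polyfun f \<and> (\<forall>x\<in>W. \<Phi> i R x = (\<Prod>K\<in>R. dotp (a K) x) * f x)"
    using assms unfolding logarithmic_on_def by blast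
  then obtain f where f: "\<forall>i\<in>I. polyfun (f i) \<and> (\<forall>x\<in>W. \<Phi> i R x = (\<Prod>K\<in>R. dotp (a K) x) * f i x)"
    by metis
  then show "\<exists>f. polyfun f \<and> (\<forall>x\<in>W. (\<Sum>i\<in>I. \<Phi> i R x) = (\<Prod>K\<in>R. dotp (a K) x) * f x)"
    by (intro exI[of _ "\<lambda>x. \<Sum>i\<in>I. f i x"] conjI polyfun_sum) (auto simp: sum_distrib_left)
qed

text \<open>
  Dividing by \<open>a\<^sub>H\<close> keeps divisibility by the forms of \<open>R\<close>, as \<open>a\<^sub>H\<close> is not proportional to any of them
  once \<open>n \<ge> 2\<close>.
\<close>

lemma logarithmic_on_cancel:
  assumes gen: "generic_on W a A n v" and n: "2 \<le> n" "n \<le> card A" and H: "H \<in> A"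
    and log: "logarithmic_on m W a A \<Psi>"
    and G: "\<And>R. R \<subseteq> A - {H} \<Longrightarrow> card R = m \<Longrightarrow> polyfun (G R)"
      "\<And>R x. R \<subseteq> A - {H} \<Longrightarrow> card R = m \<Longrightarrow> x \<in> W \<Longrightarrow> \<Psi> R x = dotp (a H) x * G R x"
  shows "logarithmic_on m W a (A - {H}) G"
  unfolding logarithmic_on_def
proof (intro allI impI)
  fix R assume R: "R \<subseteq> A - {H}" "card R = m"
  have sub: "vec.subspace W" "finite A" using gen unfolding generic_on_def by auto
  then have finR: "finite R" using R by (auto intro: finite_subset)
  obtain f where f: "\<And>x. x \<in> W \<Longrightarrow> \<Psi> R x = (\<Prod>K\<in>R. dotp (a K) x) * f x"
    using log R unfolding logarithmic_on_def by (metis Diff_subset order_trans)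
  show "\<exists>f. polyfun f \<and> (\<forall>x\<in>W. G R x = (\<Prod>K\<in>R. dotp (a K) x) * f x)"
  proof (rule polyfun_factor_prod_on_subspace[OF finR sub(1) G(1)[OF R]])
    fix K assume "K \<in> R"
    then show "\<exists>u\<in>W. dotp (a K) u \<noteq> 0"
      using generic_on_ex_neq_0[OF gen _ n(2)] n(1) R by auto
  next
    fix K L assume "K \<in> R" "L \<in> R" "K \<noteq> L"
    then show "\<exists>u\<in>W. dotp (a L) u = 0 \<and> dotp (a K) u \<noteq> 0"
      using generic_on_ex_separating[OF gen n] R by auto
  next
    fix K x assume K: "K \<in> R" and x: "x \<in> W" "dotp (a K) x = 0"
    obtain u where u: "u \<in> {x \<in> W. dotp (a K) x = 0}" "dotp (a H) u \<noteq> 0"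
      using generic_on_ex_separating[OF gen n H, of K] R K by auto
    have "\<forall>y\<in>{x \<in> W. dotp (a K) x = 0}. G R y = 0"
    proof (rule polyfun_mult_eq_0_on_subspace[OF polyfun_dotp G(1)[OF R] subspace_ker[OF sub(1)] _ u])
      fix y assume y: "y \<in> {x \<in> W. dotp (a K) x = 0}"
      then have "(\<Prod>K\<in>R. dotp (a K) y) = 0" using K finR by auto
      then show "dotp (a H) y * G R y = 0" using G(2)[OF R, of y] f[of y] y by simp
    qed
    then show "G R x = 0" using x by blast
  qed
qed

text \<open>
  In the induction step, \<open>B\<close> is \<open>A\<close> without a form \<open>H\<close> outside \<open>R0\<close>. The induction hypothesis is
  used for \<open>B\<close> on the kernel of \<open>a\<^sub>H\<close>, where \<open>n\<close> drops by one, and then for \<open>B\<close> on \<open>W\<close>. For \<open>n = 1\<close> there are no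
  generators at all, and the assertion is that the vanishing of one value forces the table to vanish.
\<close>

lemma logarithmic_multilinear_generated:
  fixes \<Phi> :: "'i set \<Rightarrow> 'k::field_char_0^'n::finite \<Rightarrow> 'k"
  assumes "generic_on W a A n v" "1 \<le> n" "1 \<le> m" "n + m \<le> Suc (card A)"
    and "\<And>R. R \<subseteq> A \<Longrightarrow> card R = m \<Longrightarrow> polyfun (\<Phi> R)"
    and "multilinear_on m W a A \<Phi>" "logarithmic_on m W a A \<Phi>"
    and "R0 \<subseteq> A" "card R0 = m" "\<And>x. x \<in> W \<Longrightarrow> \<Phi> R0 x = 0"
  shows "\<exists>g. (\<forall>T. polyfun (g T)) \<and> (\<forall>R. R \<subseteq> A \<longrightarrow> card R = m \<longrightarrow> (\<forall>x\<in>W.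
           \<Phi> R x = (\<Sum>T\<in>meeting_sets A n R0. g T x * generator a A T (v T) R x)))"
  using assms(1,2,4-10)
proof (induction "card A" arbitrary: A W n v \<Phi> rule: less_induct)
  case less
  note gen = less.prems(1) and poly = less.prems(4) and mult = less.prems(5) and log = less.prems(6)
    and R0 = less.prems(7-9)
  have fin: "finite A" and sub: "vec.subspace W" using gen unfolding generic_on_def by auto
  show ?case
  proof (cases "n + m = Suc (card A)")
    case True
    then show ?thesis using generated_boundary[OF gen _ _ log R0] less.prems(2) by blast
  next
    case False
    then have card: "n + m \<le> card A" using less.prems(3) by simp
    have nA: "n \<le> card A" using card by simp
    have "\<not> A \<subseteq> R0"
    proof
      assume "A \<subseteq> R0"
      then have "A = R0" using R0(1) by blast
      then show False using card R0(2) less.prems(2) by simp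
    qed
    then obtain H where H: "H \<in> A" "H \<notin> R0" by blast
    define B where "B = A - {H}"
    have B: "card B < card A" "Suc (card B) = card A" "R0 \<subseteq> B" "finite B" "B \<subseteq> A" "H \<notin> B"
      using H R0(1) fin card_Suc_Diff1[of A H] by (auto simp: B_def)
    have AB: "A = insert H B" using H(1) by (auto simp: B_def)
    obtain u where u: "u \<in> W" "dotp (a H) u \<noteq> 0"
      using generic_on_ex_neq_0[OF gen less.prems(2) nA H(1)] by blast
    have genB: "generic_on W a B n v" unfolding B_def by (rule generic_on_remove[OF gen])
    obtain n' where n': "n = Suc n'" using less.prems(2) by (cases n) auto
    show ?thesis
    proof (cases "n' = 0")
      case True
      have none: "meeting_sets A' n R0 = {}" if "finite A'" for A'
        using that unfolding meeting_sets_def n' True by (auto dest: finite_subset)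
      have "\<exists>g. (\<forall>T. polyfun (g T)) \<and> (\<forall>R. R \<subseteq> B \<longrightarrow> card R = m \<longrightarrow> (\<forall>x\<in>W.
           \<Phi> R x = (\<Sum>T\<in>meeting_sets B n R0. g T x * generator a B T (v T) R x)))"
      proof (rule less.hyps[OF B(1) genB less.prems(2)])
        show "n + m \<le> Suc (card B)" using card B(2) by simp
        show "multilinear_on m W a B \<Phi>" "logarithmic_on m W a B \<Phi>"
          unfolding B_def
          by (rule multilinear_on_remove[OF fin H(1) mult], rule logarithmic_on_subset[OF log], auto)
        show "polyfun (\<Phi> R)" if "R \<subseteq> B" "card R = m" for R
          using poly that B(5) by blast
      qed (use R0 B(3) in auto)
      then have "\<Phi> R x = 0" if "R \<subseteq> B" "card R = m" "x \<in> W" for R x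
        using that none[OF B(4)] by auto
      then have "\<Phi> R x = 0" if "R \<subseteq> A" "card R = m" "x \<in> W" for R x
        using multilinear_on_eq_0_extend[OF gen H(1) card assms(3) mult, of R x] that by (simp add: B_def)
      then show ?thesis
        using none[OF fin] by (intro exI[of _ "\<lambda>_ _. 0"]) (auto intro: polyfun.const)
    next
      case False
      then have n2: "2 \<le> n" using n' by simp
      let ?W = "{x \<in> W. dotp (a H) x = 0}"
      have "\<exists>g. (\<forall>T. polyfun (g T)) \<and> (\<forall>R. R \<subseteq> B \<longrightarrow> card R = m \<longrightarrow> (\<forall>x\<in>?W.
           \<Phi> R x = (\<Sum>T\<in>meeting_sets B n' R0. g T x * generator a B T (v (insert H T)) R x)))"
      proof (rule less.hyps[where v = "\<lambda>T. v (insert H T)"])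
        show "generic_on ?W a B n' (\<lambda>T. v (insert H T))"
          unfolding B_def using gen H(1) n' by (intro generic_on_restrict) auto
        show "multilinear_on m ?W a B \<Phi>"
          unfolding B_def by (rule multilinear_on_restrict[OF fin sub H(1) u mult log])
        show "logarithmic_on m ?W a B \<Phi>"
          unfolding B_def by (rule logarithmic_on_subset[OF log]) auto
        show "1 \<le> n'" "n' + m \<le> Suc (card B)" using False card B(2) n' by auto
      qed (use B(1,3,5) R0(2,3) poly in \<open>auto simp: subset_iff\<close>)
      then obtain g1 where g1: "\<And>T. polyfun (g1 T)"
        "\<And>R x. R \<subseteq> B \<Longrightarrow> card R = m \<Longrightarrow> x \<in> ?W \<Longrightarrow>
           \<Phi> R x = (\<Sum>T\<in>meeting_sets B n' R0. g1 T x * generator a B T (v (insert H T)) R x)"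
        by blast
      \<comment> \<open>the generators on the kernel, lifted to generators on \<open>W\<close>; each \<open>B - T\<close> is \<open>A - insert H T\<close>\<close>
      define E where "E R x =
        (\<Sum>T\<in>meeting_sets B n' R0. g1 T x * generator a A (insert H T) (v (insert H T)) R x)" for R x
      define \<Psi> where "\<Psi> R x = \<Phi> R x - E R x" for R x
      have T1: "insert H T \<subseteq> A" "v (insert H T) \<in> W" "\<And>K. K \<in> insert H T \<Longrightarrow> dotp (a K) (v (insert H T)) = 0"
        if "T \<in> meeting_sets B n' R0" for T
      proof -
        have "T \<subseteq> B" "Suc (card T) = n'" using that unfolding meeting_sets_def by auto
        moreover from this have "finite T" using B(4) finite_subset by blast
        ultimately have *: "insert H T \<subseteq> A" "Suc (card (insert H T)) = n"
          using B(5,6) H(1) n' by (auto simp: card_insert_if subset_iff)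
        then show "insert H T \<subseteq> A" "v (insert H T) \<in> W" "\<And>K. K \<in> insert H T \<Longrightarrow> dotp (a K) (v (insert H T)) = 0"
          using generic_on_witness[OF gen *] by auto
      qed
      have polyE: "polyfun (E R)" for R
      proof -
        have "polyfun (\<lambda>x. E R x)"
          unfolding E_def by (intro polyfun_intros g1 polyfun_generator)
        then show ?thesis .
      qed
      have multE: "multilinear_on m W a A E" unfolding E_def
        by (intro multilinear_on_sum multilinear_on_generator finite_meeting_sets B(4) T1 fin)
      have logE: "logarithmic_on m W a A E" unfolding E_def
        by (intro logarithmic_on_sum logarithmic_on_generator T1 fin g1)
      have mult\<Psi>: "multilinear_on m W a A \<Psi>" unfolding \<Psi>_def by (rule multilinear_on_diff[OF mult multE])
      have log\<Psi>: "logarithmic_on m W a A \<Psi>" unfolding \<Psi>_def by (rule logarithmic_on_diff[OF log logE])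
      have poly\<Psi>: "polyfun (\<Psi> R)" if "R \<subseteq> A" "card R = m" for R
      proof -
        have "polyfun (\<lambda>x. \<Psi> R x)"
          unfolding \<Psi>_def by (intro polyfun_diff poly polyE that)
        then show ?thesis .
      qed
      have "\<exists>G. polyfun G \<and> (\<forall>x\<in>W. \<Psi> R x = dotp (a H) x * G x)" if R: "R \<subseteq> B" "card R = m" for R
      proof (rule polyfun_factor_on_subspace[OF poly\<Psi> sub u])
        show "R \<subseteq> A" "card R = m" using R B(5) by auto
        fix x assume x: "x \<in> W" "dotp (a H) x = 0"
        have "A - insert H T = B - T" for T using AB B(6) by auto
        then have "E R x = \<Phi> R x"
          using g1(2)[OF R, of x] x unfolding E_def generator_def by simp
        then show "\<Psi> R x = 0" by (simp add: \<Psi>_def)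
      qed
      \<comment> \<open>the quotient table, defined for subsets of \<open>B\<close> only\<close>
      then obtain G where G: "\<And>R. R \<subseteq> B \<Longrightarrow> card R = m \<Longrightarrow> polyfun (G R)"
        "\<And>R x. R \<subseteq> B \<Longrightarrow> card R = m \<Longrightarrow> x \<in> W \<Longrightarrow> \<Psi> R x = dotp (a H) x * G R x"
        by metis
      have GR0: "G R0 x = 0" if "x \<in> W" for x
      proof -
        have "E R0 y = 0" for y
          unfolding E_def
        proof (intro sum.neutral ballI)
          fix T assume T: "T \<in> meeting_sets B n' R0"
          then obtain K where "K \<in> T" "K \<in> R0" unfolding meeting_sets_def by auto
          moreover have "finite R0" using R0(1) fin finite_subset by blast
          ultimately have "generator a A (insert H T) (v (insert H T)) R0 y = 0"
            using T1[OF T] by (intro generator_eq_0) auto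
          then show "g1 T y * generator a A (insert H T) (v (insert H T)) R0 y = 0" by simp
        qed
        then have "dotp (a H) y * G R0 y = 0" if "y \<in> W" for y
          using G(2)[of R0 y] that B(3) R0(2) R0(3)[OF that] by (simp add: \<Psi>_def)
        then have "\<forall>y\<in>W. G R0 y = 0"
          using B(3) R0(2) by (intro polyfun_mult_eq_0_on_subspace[OF polyfun_dotp G(1) sub _ u]) auto
        then show ?thesis using that by blast
      qed
      have "\<exists>g. (\<forall>T. polyfun (g T)) \<and> (\<forall>R. R \<subseteq> B \<longrightarrow> card R = m \<longrightarrow> (\<forall>x\<in>W.
           G R x = (\<Sum>T\<in>meeting_sets B n R0. g T x * generator a B T (v T) R x)))"
      proof (rule less.hyps)
        show "multilinear_on m W a B G"
          by (rule multilinear_on_cancel[OF sub u B(4)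
                multilinear_on_remove[OF fin H(1) mult\<Psi>, folded B_def] G])
        show "logarithmic_on m W a B G"
          by (rule logarithmic_on_cancel[OF gen n2 nA H(1) log\<Psi>, folded B_def, OF G])
        show "n + m \<le> Suc (card B)" using card B(2) by simp
      qed (use B(1,3) genB G(1) less.prems(2) R0(2) GR0 in auto)
      then obtain g2 where g2: "\<And>T. polyfun (g2 T)"
        "\<And>R x. R \<subseteq> B \<Longrightarrow> card R = m \<Longrightarrow> x \<in> W \<Longrightarrow>
           G R x = (\<Sum>T\<in>meeting_sets B n R0. g2 T x * generator a B T (v T) R x)"
        by blast
      \<comment> \<open>multiplying the generators of \<open>B\<close> by \<open>a\<^sub>H\<close> turns them into generators of \<open>A\<close>\<close>
      define F where "F R x = (\<Sum>T\<in>meeting_sets B n R0. g2 T x * generator a A T (v T) R x)" for R x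
      have T2: "v T \<in> W" "H \<notin> T" if "T \<in> meeting_sets B n R0" for T
      proof -
        have T: "T \<subseteq> B" "Suc (card T) = n" using that unfolding meeting_sets_def by auto
        then have "T \<subseteq> A" using B(5) by blast
        then show "v T \<in> W" using generic_on_witness[OF gen _ T(2)] by blast
        show "H \<notin> T" using T(1) B(6) by blast
      qed
      have multF: "multilinear_on m W a A F" unfolding F_def
        by (intro multilinear_on_sum multilinear_on_generator finite_meeting_sets B(4) T2 fin)
      have "\<Psi> R x - F R x = 0" if R: "R \<subseteq> A" "card R = m" and x: "x \<in> W" for R x
      proof (rule multilinear_on_eq_0_extend[OF gen H(1) card assms(3) _ _ R x])
        show "multilinear_on m W a A (\<lambda>R x. \<Psi> R x - F R x)" by (rule multilinear_on_diff[OF mult\<Psi> multF])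
      next
        fix R x assume R: "R \<subseteq> A - {H}" "card R = m" and x: "x \<in> W"
        have "generator a A T (v T) R x = dotp (a H) x * generator a B T (v T) R x"
          if "T \<in> meeting_sets B n R0" for T
        proof -
          have "A - T = insert H (B - T)" using T2(2)[OF that] AB by auto
          then show ?thesis using B(4,6) by (simp add: generator_def)
        qed
        then have "F R x = dotp (a H) x * G R x"
          using g2(2)[of R x] R x unfolding F_def B_def[symmetric]
          by (simp add: sum_distrib_left mult.left_commute cong: sum.cong)
        then show "\<Psi> R x - F R x = 0" using G(2)[of R x] R x unfolding B_def by simp
      qed
      then have eq: "\<Phi> R x = F R x + E R x" if "R \<subseteq> A" "card R = m" "x \<in> W" for R x
        using that unfolding \<Psi>_def by (metis diff_eq_eq eq_iff_diff_eq_0)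
      define g where "g T = (if H \<in> T then g1 (T - {H}) else g2 T)" for T
      have "(\<Sum>T\<in>meeting_sets A n R0. g T x * generator a A T (v T) R x) = F R x + E R x" for R x
      proof -
        have nH: "H \<notin> T" if "T \<in> meeting_sets B k R0" for T k
          using that B(6) unfolding meeting_sets_def by auto
        have inj: "inj_on (insert H) (meeting_sets B n' R0)"
          using nH by (intro inj_onI) (metis insert_ident)
        have "(\<Sum>T\<in>meeting_sets A n R0. g T x * generator a A T (v T) R x) =
            (\<Sum>T\<in>meeting_sets B n R0. g T x * generator a A T (v T) R x) +
            (\<Sum>T\<in>insert H ` meeting_sets B n' R0. g T x * generator a A T (v T) R x)"
          unfolding n' meeting_sets_remove[OF fin H] B_def[symmetric]
          using nH B(4) by (intro sum.union_disjoint) (auto simp: finite_meeting_sets)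
        also have "(\<Sum>T\<in>meeting_sets B n R0. g T x * generator a A T (v T) R x) = F R x"
          unfolding F_def using nH by (intro sum.cong) (auto simp: g_def)
        also have "(\<Sum>T\<in>insert H ` meeting_sets B n' R0. g T x * generator a A T (v T) R x) = E R x"
          unfolding E_def sum.reindex[OF inj] using nH by (intro sum.cong) (auto simp: g_def)
        finally show ?thesis .
      qed
      moreover have "polyfun (g T)" for T
        using g1(1) g2(1) by (simp add: g_def)
      ultimately show ?thesis using eq by (intro exI[of _ g]) auto
    qed
  qed
qed

section \<open>Polynomials, evaluation and partial derivatives\<close>

lemma mpoly_eq_sum_single:
  fixes f :: "'a \<Rightarrow>\<^sub>0 'b::comm_monoid_add"
  shows "f = (\<Sum>\<alpha>\<in>Poly_Mapping.keys f. Poly_Mapping.single \<alpha> (Poly_Mapping.lookup f \<alpha>))"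
  by (intro poly_mapping_eqI) (simp add: lookup_sum lookup_single when_def sum.delta in_keys_iff)

lemma mpoly_induct [case_names single add]:
  fixes f :: "'a \<Rightarrow>\<^sub>0 'b::comm_monoid_add"
  assumes "\<And>\<alpha> c. P (Poly_Mapping.single \<alpha> c)" "\<And>f g. P f \<Longrightarrow> P g \<Longrightarrow> P (f + g)"
  shows "P f"
proof -
  have "P (\<Sum>\<alpha>\<in>I. Poly_Mapping.single \<alpha> (Poly_Mapping.lookup f \<alpha>))" for I
  proof (induction I rule: infinite_finite_induct)
    case (insert x F)
    then show ?case using assms by simp
  qed (use assms(1)[of _ 0] in simp_all)
  then show ?thesis by (subst mpoly_eq_sum_single)
qed

definition eval_monom :: "('k::field_char_0)^('n::finite) \<Rightarrow> ('n \<Rightarrow>\<^sub>0 nat) \<Rightarrow> 'k" where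
  "eval_monom v \<alpha> = (\<Prod>i\<in>UNIV. (v $ i) ^ Poly_Mapping.lookup \<alpha> i)"

lemma mpoly_eval_superset:
  assumes "finite I" "Poly_Mapping.keys f \<subseteq> I"
  shows "mpoly_eval v f = (\<Sum>\<alpha>\<in>I. Poly_Mapping.lookup f \<alpha> * eval_monom v \<alpha>)"
  unfolding mpoly_eval_def eval_monom_def
  by (rule sum.mono_neutral_left) (use assms in \<open>auto simp: in_keys_iff\<close>)

lemma mpoly_eval_add: "mpoly_eval v (f + g) = mpoly_eval v f + mpoly_eval v g"
proof -
  let ?I = "Poly_Mapping.keys f \<union> Poly_Mapping.keys g"
  have "Poly_Mapping.keys (f + g) \<subseteq> ?I" by (rule keys_add)
  then show ?thesis
    by (simp add: mpoly_eval_superset[of ?I] lookup_add algebra_simps sum.distrib)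
qed

lemma mpoly_eval_single: "mpoly_eval v (Poly_Mapping.single \<alpha> c) = c * eval_monom v \<alpha>"
  by (subst mpoly_eval_superset[of "{\<alpha>}"]) auto

lemma eval_monom_add: "eval_monom v (\<alpha> + \<beta>) = eval_monom v \<alpha> * eval_monom v \<beta>"
  by (simp add: eval_monom_def lookup_add power_add prod.distrib)

lemma mpoly_eval_mult: "mpoly_eval v (f * g) = mpoly_eval v f * mpoly_eval v g"
proof (induction f rule: mpoly_induct)
  case (single \<alpha> c)
  show ?case
    by (induction g rule: mpoly_induct)
      (simp_all add: mult_single mpoly_eval_single eval_monom_add distrib_left mpoly_eval_add)
next
  case (add f h)
  then show ?case by (simp add: distrib_right mpoly_eval_add)
qed

lemma mpoly_eval_0: "mpoly_eval v 0 = 0"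
  by (simp add: mpoly_eval_def)

lemma mpoly_eval_Const: "mpoly_eval v (Const c) = c"
  by (simp add: Const_def mpoly_eval_single eval_monom_def)

lemma Const_1: "Const 1 = 1" by (simp add: Const_def)

lemma mpoly_eval_1: "mpoly_eval v 1 = 1"
  using mpoly_eval_Const[of v 1] by (simp add: Const_1)

lemma eval_monom_single: "eval_monom v (Poly_Mapping.single i k) = v $ i ^ k"
proof -
  have "eval_monom v (Poly_Mapping.single i k) = (\<Prod>j\<in>UNIV. if j = i then v $ i ^ k else 1)"
    unfolding eval_monom_def by (intro prod.cong) (auto simp: lookup_single when_def)
  then show ?thesis by (simp add: prod.delta)
qed

lemma mpoly_eval_Var: "mpoly_eval v (Var i) = v $ i"
  by (simp add: Var_def mpoly_eval_single eval_monom_single)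

lemma mpoly_eval_sum: "mpoly_eval v (\<Sum>i\<in>I. f i) = (\<Sum>i\<in>I. mpoly_eval v (f i))"
  by (induction I rule: infinite_finite_induct) (auto simp: mpoly_eval_add mpoly_eval_0)

lemma mpoly_eval_prod: "mpoly_eval v (\<Prod>i\<in>I. f i) = (\<Prod>i\<in>I. mpoly_eval v (f i))"
  by (induction I rule: infinite_finite_induct) (auto simp: mpoly_eval_mult mpoly_eval_1)

lemma mpoly_eval_power: "mpoly_eval v (f ^ k) = mpoly_eval v f ^ k"
  by (induction k) (auto simp: mpoly_eval_mult mpoly_eval_1)

lemma mpoly_eval_diff: "mpoly_eval v (f - g) = mpoly_eval v f - mpoly_eval v g"
  using mpoly_eval_add[of v "f - g" g] by simp

lemmas mpoly_eval_simps = mpoly_eval_add mpoly_eval_mult mpoly_eval_0 mpoly_eval_1 mpoly_eval_Const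
  mpoly_eval_sum mpoly_eval_prod mpoly_eval_power mpoly_eval_diff mpoly_eval_Var

lemma mpoly_eval_linear_form: "mpoly_eval v (linear_form c) = dotp c v"
  by (simp add: linear_form_def dotp_def mpoly_eval_simps)

lemma polyfun_mpoly_eval: "polyfun (\<lambda>x. mpoly_eval x f)"
  unfolding mpoly_eval_def by (intro polyfun_intros)

lemma polyfun_imp_mpoly_eval: "polyfun f \<Longrightarrow> \<exists>g. \<forall>x. f x = mpoly_eval x g"
proof (induction rule: polyfun.induct)
  case (const c)
  then show ?case by (metis mpoly_eval_Const)
next
  case (coord i)
  then show ?case by (metis mpoly_eval_Var)
next
  case (add f g)
  then show ?case by (metis mpoly_eval_add)
next
  case (mult f g)
  then show ?case by (metis mpoly_eval_mult)
qed

lemma partial_add: "partial i (f + g) = partial i f + partial i g"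
  by (intro poly_mapping_eqI) (simp add: lookup_partial lookup_add algebra_simps)

lemma partial_single:
  "partial i (Poly_Mapping.single \<alpha> c) =
     Poly_Mapping.single (\<alpha> - Poly_Mapping.single i 1) (of_nat (Poly_Mapping.lookup \<alpha> i) * c)"
  by (cases "c = 0") (auto simp: partial_def)

lemma exponent_diff_add:
  assumes "Poly_Mapping.lookup \<alpha> i \<noteq> 0"
  shows "\<alpha> - Poly_Mapping.single i 1 + Poly_Mapping.single i (1::nat) = \<alpha>"
  using assms by (intro poly_mapping_eqI) (auto simp: lookup_add lookup_minus lookup_single when_def)

lemma partial_mult:
  fixes f g :: "('k::field_char_0, 'n::finite) mpoly"
  shows "partial i (f * g) = partial i f * g + f * partial i g"
proof (induction f rule: mpoly_induct)
  case (single \<alpha> c)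
  show ?case
  proof (induction g rule: mpoly_induct)
    case (single \<beta> d)
    let ?e = "Poly_Mapping.single i (1::nat)"
    have 1: "Poly_Mapping.single (\<alpha> + \<beta> - ?e) (of_nat (Poly_Mapping.lookup \<alpha> i) * (c * d)) =
        Poly_Mapping.single (\<alpha> - ?e + \<beta>) (of_nat (Poly_Mapping.lookup \<alpha> i) * (c * d))"
      for \<alpha> \<beta> :: "'n \<Rightarrow>\<^sub>0 nat"
    proof (cases "Poly_Mapping.lookup \<alpha> i = 0")
      case False
      then have "\<alpha> + \<beta> - ?e = \<alpha> - ?e + \<beta>"
        by (intro poly_mapping_eqI) (auto simp: lookup_add lookup_minus lookup_single when_def)
      then show ?thesis by simp
    qed simp
    show ?case
      using 1[of \<alpha> \<beta>] 1[of \<beta> \<alpha>]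
      by (simp add: mult_single partial_single lookup_add add.commute algebra_simps single_add)
  next
    case (add g h)
    then show ?case by (simp add: distrib_left partial_add algebra_simps)
  qed
next
  case (add f h)
  then show ?case by (simp add: distrib_right partial_add algebra_simps)
qed

text \<open>
  Along a line parallel to the \<open>i\<close>-th axis, \<open>f\<close> is a polynomial in one variable with infinitely many zeros.
\<close>

lemma mpoly_eval_partial_eq_0:
  fixes f :: "('k::field_char_0, 'n::finite) mpoly"
  assumes "\<And>v. mpoly_eval v f = 0"
  shows "mpoly_eval v (partial i f) = 0"
proof -
  define c where "c \<alpha> = Poly_Mapping.lookup f \<alpha> * (\<Prod>j\<in>UNIV - {i}. v $ j ^ Poly_Mapping.lookup \<alpha> j)" for \<alpha>
  define q where "q = (\<Sum>\<alpha>\<in>Poly_Mapping.keys f. smult (c \<alpha>) (monom 1 (Poly_Mapping.lookup \<alpha> i)))"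
  have split: "eval_monom w \<alpha> = w $ i ^ Poly_Mapping.lookup \<alpha> i * (\<Prod>j\<in>UNIV - {i}. w $ j ^ Poly_Mapping.lookup \<alpha> j)" for w :: "'k^'n" and \<alpha>
    unfolding eval_monom_def by (rule prod.remove) auto
  have rest: "(\<Prod>j\<in>UNIV - {i}. (if j = i then t else v $ j) ^ Poly_Mapping.lookup \<alpha> j) =
      (\<Prod>j\<in>UNIV - {i}. v $ j ^ Poly_Mapping.lookup \<alpha> j)" for t \<alpha>
    by (intro prod.cong) auto
  have "poly q t = mpoly_eval (\<chi> j. if j = i then t else v $ j) f" for t
    by (simp add: q_def poly_sum poly_monom mpoly_eval_superset[of "Poly_Mapping.keys f"] split rest c_def
        mult_ac)
  then have "q = 0" using assms by (metis poly_0 poly_eq_poly_eq_iff ext)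
  then have "poly (pderiv q) (v $ i) = 0" by simp
  moreover have "mpoly_eval v (partial i f) = poly (pderiv q) (v $ i)"
  proof -
    have "mpoly_eval v (Poly_Mapping.single (\<alpha> - Poly_Mapping.single i 1) (of_nat (Poly_Mapping.lookup \<alpha> i) * Poly_Mapping.lookup f \<alpha>)) =
      poly (pderiv (smult (c \<alpha>) (monom 1 (Poly_Mapping.lookup \<alpha> i)))) (v $ i)" for \<alpha>
    proof -
      have "(\<Prod>j\<in>UNIV - {i}. v $ j ^ Poly_Mapping.lookup (\<alpha> - Poly_Mapping.single i 1) j) =
        (\<Prod>j\<in>UNIV - {i}. v $ j ^ Poly_Mapping.lookup \<alpha> j)"
        by (intro prod.cong) (auto simp: lookup_minus lookup_single)
      then show ?thesis
        by (simp add: mpoly_eval_single split pderiv_smult pderiv_monom poly_monom c_def lookup_minus mult_ac)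
    qed
    then show ?thesis
      unfolding partial_def q_def
      by (simp add: mpoly_eval_sum poly_sum higher_pderiv_sum[of 1, simplified])
  qed
  ultimately show ?thesis by simp
qed

lemma mdeg_add: "mdeg (\<alpha> + \<beta>) = mdeg \<alpha> + mdeg \<beta>"
  by (simp add: mdeg_def lookup_add sum.distrib)

lemma mdeg_single: "mdeg (Poly_Mapping.single i k) = k"
proof -
  have "mdeg (Poly_Mapping.single i k) = (\<Sum>j\<in>UNIV. if j = i then k else 0)"
    unfolding mdeg_def by (intro sum.cong) (auto simp: lookup_single when_def)
  then show ?thesis by simp
qed

lemma mdeg_eq_0_iff: "mdeg \<alpha> = 0 \<longleftrightarrow> \<alpha> = 0"
  unfolding mdeg_def by (auto intro!: poly_mapping_eqI)

lemma exponent_induct [case_names 0 Suc]: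
  assumes "P 0" "\<And>\<alpha> i. P \<alpha> \<Longrightarrow> P (\<alpha> + Poly_Mapping.single i 1)"
  shows "P (\<alpha> :: 'n::finite \<Rightarrow>\<^sub>0 nat)"
proof (induction "mdeg \<alpha>" arbitrary: \<alpha>)
  case 0
  then have "\<alpha> = 0" by (simp add: mdeg_eq_0_iff)
  then show ?case using assms(1) by simp
next
  case (Suc k)
  then have "\<alpha> \<noteq> 0" using mdeg_eq_0_iff[of \<alpha>] by simp
  then obtain i where i: "Poly_Mapping.lookup \<alpha> i \<noteq> 0" by (metis poly_mapping_eqI lookup_zero)
  let ?\<beta> = "\<alpha> - Poly_Mapping.single i 1"
  have eq: "\<alpha> = ?\<beta> + Poly_Mapping.single i 1" using exponent_diff_add[OF i] by simp
  then have "mdeg \<alpha> = Suc (mdeg ?\<beta>)" by (metis mdeg_add mdeg_single Suc_eq_plus1)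
  then have "P ?\<beta>" using Suc by simp
  then show ?case using assms(2) eq by metis
qed

text \<open>
  All iterated derivatives of a polynomial that vanishes as a function vanish as functions too, in particular
  at the origin, where they give the coefficients up to factorials.
\<close>

lemma mpoly_eqI:
  fixes f g :: "('k::field_char_0, 'n::finite) mpoly"
  assumes "\<And>v. mpoly_eval v f = mpoly_eval v g"
  shows "f = g"
proof -
  have "Poly_Mapping.lookup h \<alpha> = 0" if "\<forall>v. mpoly_eval v h = 0" for \<alpha> and h :: "('k, 'n) mpoly"
    using that
  proof (induction \<alpha> arbitrary: h rule: exponent_induct)
    case 0
    have "mpoly_eval 0 h = (\<Sum>\<alpha>\<in>insert 0 (Poly_Mapping.keys h). Poly_Mapping.lookup h \<alpha> * eval_monom 0 \<alpha>)"
      by (rule mpoly_eval_superset) auto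
    also have "\<dots> = (\<Sum>\<alpha>\<in>{0}. Poly_Mapping.lookup h \<alpha> * eval_monom 0 \<alpha>)"
    proof (intro sum.mono_neutral_right ballI)
      fix \<alpha> :: "'n \<Rightarrow>\<^sub>0 nat" assume "\<alpha> \<in> insert 0 (Poly_Mapping.keys h) - {0}"
      then have "\<alpha> \<noteq> 0" by blast
      then obtain i where i: "Poly_Mapping.lookup \<alpha> i \<noteq> 0" by (metis poly_mapping_eqI lookup_zero)
      then have "eval_monom 0 \<alpha> = (0::'k)" by (auto simp: eval_monom_def intro!: exI[of _ i])
      then show "Poly_Mapping.lookup h \<alpha> * eval_monom 0 \<alpha> = 0" by simp
    qed auto
    finally show ?case using 0 by (simp add: eval_monom_def)
  next
    case (Suc \<alpha> i)
    have "Poly_Mapping.lookup (partial i h) \<alpha> = 0"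
      using Suc mpoly_eval_partial_eq_0 by blast
    then show ?case by (simp add: lookup_partial del: of_nat_Suc)
  qed
  then have "f - g = 0"
    using assms by (intro poly_mapping_eqI) (simp add: mpoly_eval_diff)
  then show ?thesis by simp
qed

section \<open>Homogeneous differential operators\<close>

lemma partial_pow_fold_insert:
  fixes \<alpha> :: "'n::finite \<Rightarrow>\<^sub>0 nat" and I :: "'n set"
  assumes "j \<notin> I"
  shows "Finite_Set.fold (\<lambda>i \<theta>. (partial i ^^ Poly_Mapping.lookup \<alpha> i) \<circ> \<theta>) id (insert j I) =
    (partial j ^^ Poly_Mapping.lookup \<alpha> j) \<circ>
      (Finite_Set.fold (\<lambda>i \<theta>. (partial i ^^ Poly_Mapping.lookup \<alpha> i) \<circ> \<theta>) id I :: ('k::field_char_0, 'n) mop)"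
proof -
  interpret comp_fun_commute "\<lambda>i (\<theta> :: ('k, 'n) mop). (partial i ^^ Poly_Mapping.lookup \<alpha> i) \<circ> \<theta>"
    by (rule comp_fun_commute_partial)
  show ?thesis using assms by (intro fold_insert) auto
qed

lemma partial_pow_0: "partial_pow 0 = (id :: ('k::field_char_0, 'n::finite) mop)"
proof -
  have *: "Finite_Set.fold (\<lambda>i \<theta>. (partial i ^^ Poly_Mapping.lookup 0 i) \<circ> \<theta>) (id :: ('k, 'n) mop) I = id"
    if "finite I" for I :: "'n set"
    using that
  proof (induction I)
    case (insert i I)
    show ?case
      unfolding partial_pow_fold_insert[OF insert.hyps(2)] insert.IH by simp
  qed simp
  show ?thesis unfolding partial_pow_def by (rule *) simp
qed

lemma partial_pow_add_single:
  "partial_pow (\<alpha> + Poly_Mapping.single i 1) = (partial i \<circ> partial_pow \<alpha> :: ('k::field_char_0, 'n::finite) mop)"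
proof -
  define F :: "('n \<Rightarrow>\<^sub>0 nat) \<Rightarrow> 'n set \<Rightarrow> ('k, 'n) mop"
    where "F \<alpha> = Finite_Set.fold (\<lambda>i \<theta>. (partial i ^^ Poly_Mapping.lookup \<alpha> i) \<circ> \<theta>) id" for \<alpha>
  have ins: "F \<alpha> (insert j I) = (partial j ^^ Poly_Mapping.lookup \<alpha> j) \<circ> F \<alpha> I" if "j \<notin> I" for \<alpha> j I
    unfolding F_def by (rule partial_pow_fold_insert[OF that])
  have same: "F (\<alpha> + Poly_Mapping.single i 1) I = F \<alpha> I" if "finite I" "i \<notin> I" for I
    using that
  proof (induction I)
    case (insert j I)
    then show ?case by (auto simp: ins lookup_add lookup_single)
  qed (simp add: F_def)
  have "UNIV = insert i (UNIV - {i})" by blast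
  then have split: "partial_pow \<alpha> = (partial i ^^ Poly_Mapping.lookup \<alpha> i) \<circ> F \<alpha> (UNIV - {i})" for \<alpha>
    using ins[where I = "UNIV - {i}" and j = i and \<alpha> = \<alpha>] by (simp add: partial_pow_def F_def)
  have "F (\<alpha> + Poly_Mapping.single i 1) (UNIV - {i}) = F \<alpha> (UNIV - {i})"
    by (intro same) auto
  then show ?thesis
    unfolding split by (simp add: lookup_add comp_assoc)
qed

lemma sum_op_apply: "(\<Sum>i\<in>I. F i) f = (\<Sum>i\<in>I. F i f)"
  for F :: "'i \<Rightarrow> 'a \<Rightarrow> 'b::comm_monoid_add"
  by (induction I rule: infinite_finite_induct) auto

lemma Const_mult: "Const (a * b) = Const a * Const b"
  and Const_0: "Const 0 = 0"
  and Const_of_nat: "Const (of_nat k) = of_nat k"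
  by (simp_all add: Const_def mult_single)

lemma Const_cancel:
  assumes "c \<noteq> 0" "Const c * f = 0"
  shows "f = 0"
proof -
  have "Const (inverse c) * (Const c * f) = 0" using assms(2) by simp
  then show ?thesis using assms(1) by (simp add: mult.assoc[symmetric] Const_mult[symmetric] Const_1)
qed

lemma partial_Const: "partial i (Const c) = 0"
  by (simp add: Const_def partial_single)

lemma partial_Const_mult: "partial i (Const c * f) = Const c * partial i f"
  by (simp add: partial_mult partial_Const)

lemma partial_1: "partial i 1 = 0"
  using partial_Const[of i 1] by (simp add: Const_1)

lemma partial_0: "partial i 0 = 0"
  using partial_Const[of i 0] by (simp add: Const_0)

lemma partial_sum: "partial i (\<Sum>j\<in>I. f j) = (\<Sum>j\<in>I. partial i (f j))"
  by (induction I rule: infinite_finite_induct) (simp_all add: partial_add partial_0)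

lemma partial_Var: "partial i (Var j) = (if i = j then 1 else 0)"
  by (auto simp: Var_def partial_single lookup_single when_def)

lemma partial_linear_form: "partial i (linear_form a) = Const (a $ i)"
  by (simp add: linear_form_def partial_sum partial_Const_mult partial_Var if_distrib
      cong: if_cong)

text \<open>
  This is linearity over the field, whose elements act on polynomials as \<open>Const c\<close>.
\<close>

definition const_linear :: "('k::field_char_0, 'n::finite) mop \<Rightarrow> bool" where
  "const_linear \<theta> \<longleftrightarrow> (\<forall>f g. \<theta> (f + g) = \<theta> f + \<theta> g) \<and> (\<forall>c f. \<theta> (Const c * f) = Const c * \<theta> f)"

lemma const_linear_add: "const_linear \<theta> \<Longrightarrow> \<theta> (f + g) = \<theta> f + \<theta> g"
  and const_linear_scale: "const_linear \<theta> \<Longrightarrow> \<theta> (Const c * f) = Const c * \<theta> f"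
  by (simp_all add: const_linear_def)

lemma const_linear_0: "const_linear \<theta> \<Longrightarrow> \<theta> 0 = 0"
  using const_linear_scale[of \<theta> 0 0] by (simp add: Const_0)

lemma const_linear_sum: "const_linear \<theta> \<Longrightarrow> \<theta> (\<Sum>i\<in>I. f i) = (\<Sum>i\<in>I. \<theta> (f i))"
  by (induction I rule: infinite_finite_induct) (simp_all add: const_linear_add const_linear_0)

lemma const_linear_partial: "const_linear (partial i)"
  by (simp add: const_linear_def partial_add partial_Const_mult)

lemma const_linear_comp: "const_linear \<theta> \<Longrightarrow> const_linear \<eta> \<Longrightarrow> const_linear (\<theta> \<circ> \<eta>)"
  by (simp add: const_linear_def)

lemma const_linear_partial_pow: "const_linear (partial_pow \<alpha>)"
proof (induction \<alpha> rule: exponent_induct)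
  case 0
  then show ?case by (simp add: partial_pow_0 const_linear_def)
next
  case (Suc \<alpha> i)
  then show ?case
    by (simp only: partial_pow_add_single const_linear_comp const_linear_partial)
qed

lemma partial_pow_partial: "partial_pow \<alpha> (partial i f) = partial_pow (\<alpha> + Poly_Mapping.single i 1) f"
proof (induction \<alpha> rule: exponent_induct)
  case 0
  show ?case using partial_pow_add_single[of 0 i, THEN fun_cong, of f] by (simp add: partial_pow_0)
next
  case (Suc \<alpha> j)
  have "\<alpha> + Poly_Mapping.single j 1 + Poly_Mapping.single i 1 =
      \<alpha> + Poly_Mapping.single i (1::nat) + Poly_Mapping.single j 1" by (simp add: add_ac)
  then show ?case
    using Suc by (simp only: partial_pow_add_single comp_apply)
qed

lemma hom_opsE:
  fixes \<theta> :: "('k::field_char_0, 'n::finite) mop"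
  assumes "\<theta> \<in> hom_ops m"
  obtains c where "\<theta> = (\<lambda>f. \<Sum>\<alpha> | mdeg \<alpha> = m. c \<alpha> * partial_pow \<alpha> f)"
proof -
  let ?V = "{\<theta> :: ('k, 'n) mop. \<exists>c. \<theta> = (\<lambda>f. \<Sum>\<alpha> | mdeg \<alpha> = m. c \<alpha> * partial_pow \<alpha> f)}"
  have "hom_ops m \<subseteq> ?V"
    unfolding hom_ops_def
  proof (rule ops.span_minimal)
    show "{partial_pow \<alpha> |\<alpha>. mdeg \<alpha> = m} \<subseteq> ?V"
    proof
      fix \<eta> :: "('k, 'n) mop" assume "\<eta> \<in> {partial_pow \<alpha> |\<alpha>. mdeg \<alpha> = m}"
      then obtain \<beta> where \<beta>: "\<eta> = partial_pow \<beta>" "mdeg \<beta> = m" by blast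
      have "\<eta> = (\<lambda>f. \<Sum>\<alpha> | mdeg \<alpha> = m. (if \<alpha> = \<beta> then 1 else 0) * partial_pow \<alpha> f)"
        using \<beta> by (intro ext) (simp add: if_distrib[of "\<lambda>x. x * _"] finite_mdeg_eq cong: if_cong)
      then show "\<eta> \<in> ?V"
        by (intro CollectI exI[of _ "\<lambda>\<alpha>. if \<alpha> = \<beta> then 1 else 0"])
    qed
    show "ops.subspace ?V"
    proof (rule ops.subspaceI)
      show "0 \<in> ?V"
        by (intro CollectI exI[of _ "\<lambda>_. 0"]) (simp add: fun_eq_iff)
    next
      fix \<theta> \<eta> assume "\<theta> \<in> ?V" "\<eta> \<in> ?V"
      then obtain c d where "\<theta> = (\<lambda>f. \<Sum>\<alpha> | mdeg \<alpha> = m. c \<alpha> * partial_pow \<alpha> f)"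
        "\<eta> = (\<lambda>f. \<Sum>\<alpha> | mdeg \<alpha> = m. d \<alpha> * partial_pow \<alpha> f)" by blast
      then have "\<theta> + \<eta> = (\<lambda>f. \<Sum>\<alpha> | mdeg \<alpha> = m. (c \<alpha> + d \<alpha>) * partial_pow \<alpha> f)"
        by (simp add: fun_eq_iff distrib_right sum.distrib)
      then show "\<theta> + \<eta> \<in> ?V" by (intro CollectI exI[of _ "\<lambda>\<alpha>. c \<alpha> + d \<alpha>"])
    next
      fix s \<theta> assume "\<theta> \<in> ?V"
      then obtain c where "\<theta> = (\<lambda>f. \<Sum>\<alpha> | mdeg \<alpha> = m. c \<alpha> * partial_pow \<alpha> f)" by blast
      then have "op_scale s \<theta> = (\<lambda>f. \<Sum>\<alpha> | mdeg \<alpha> = m. (s * c \<alpha>) * partial_pow \<alpha> f)"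
        by (simp add: fun_eq_iff op_scale_def sum_distrib_left mult.assoc)
      then show "op_scale s \<theta> \<in> ?V" by (intro CollectI exI[of _ "\<lambda>\<alpha>. s * c \<alpha>"])
    qed
  qed
  then show thesis using assms that by blast
qed

lemma const_linear_hom_ops:
  assumes "\<theta> \<in> hom_ops m"
  shows "const_linear \<theta>"
proof -
  obtain c where \<theta>: "\<theta> = (\<lambda>f. \<Sum>\<alpha> | mdeg \<alpha> = m. c \<alpha> * partial_pow \<alpha> f)"
    using assms by (rule hom_opsE)
  show ?thesis
    unfolding const_linear_def \<theta>
    by (simp add: const_linear_add[OF const_linear_partial_pow] const_linear_scale[OF const_linear_partial_pow]
        distrib_left sum.distrib sum_distrib_left mult.left_commute)
qed

lemma lookup_partial_pow:
  "\<exists>k::'k::field_char_0. k \<noteq> 0 \<and> (\<forall>f. Poly_Mapping.lookup (partial_pow \<alpha> f) \<gamma> = k * Poly_Mapping.lookup f (\<gamma> + \<alpha>))"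
proof (induction \<alpha> arbitrary: \<gamma> rule: exponent_induct)
  case 0
  show ?case by (intro exI[of _ 1]) (simp add: partial_pow_0)
next
  case (Suc \<alpha> i)
  obtain k :: 'k where k: "k \<noteq> 0"
    "\<And>f. Poly_Mapping.lookup (partial_pow \<alpha> f) (\<gamma> + Poly_Mapping.single i 1) =
      k * Poly_Mapping.lookup f (\<gamma> + Poly_Mapping.single i 1 + \<alpha>)"
    using Suc by blast
  have eq: "Poly_Mapping.lookup (partial_pow (\<alpha> + Poly_Mapping.single i 1) f) \<gamma> =
      of_nat (Suc (Poly_Mapping.lookup \<gamma> i)) * k * Poly_Mapping.lookup f (\<gamma> + (\<alpha> + Poly_Mapping.single i 1))"
    for f :: "('k, _) mpoly"
    by (simp only: partial_pow_add_single comp_apply lookup_partial k(2) mult.assoc add_ac)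
  have nz: "of_nat (Suc (Poly_Mapping.lookup \<gamma> i)) * k \<noteq> 0"
    using k(1) by (simp del: of_nat_Suc)
  show ?case using eq nz by blast
qed

text \<open>
  Derivatives of order \<open>m\<close> and monomials of degree \<open>m\<close> are dual to each other up to factorials, so the
  coefficients of an operator in \<open>hom_ops m\<close> can be read off from its values on monomials.
\<close>

lemma partial_pow_monomial:
  fixes \<alpha> \<beta> :: "'n::finite \<Rightarrow>\<^sub>0 nat"
  assumes "mdeg \<alpha> = mdeg \<beta>"
  shows "\<exists>k::'k::field_char_0. k \<noteq> 0 \<and>
    partial_pow \<beta> (Poly_Mapping.single \<alpha> 1) = (if \<beta> = \<alpha> then Const k else 0)"
proof -
  have shift: "\<alpha> = \<gamma> + \<beta> \<longleftrightarrow> \<gamma> = 0 \<and> \<beta> = \<alpha>" for \<gamma>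
  proof
    assume eq: "\<alpha> = \<gamma> + \<beta>"
    then have "mdeg \<gamma> = 0" using assms by (simp add: mdeg_add)
    then show "\<gamma> = 0 \<and> \<beta> = \<alpha>" using eq by (simp add: mdeg_eq_0_iff)
  qed simp
  obtain k :: 'k where k: "k \<noteq> 0"
    "\<And>f. Poly_Mapping.lookup (partial_pow \<beta> f) 0 = k * Poly_Mapping.lookup f (0 + \<beta>)"
    using lookup_partial_pow by blast
  have "Poly_Mapping.lookup (partial_pow \<beta> (Poly_Mapping.single \<alpha> (1::'k))) \<gamma> =
      Poly_Mapping.lookup (if \<beta> = \<alpha> then Const k else 0) \<gamma>" for \<gamma>
  proof (cases "\<gamma> = 0")
    case True
    then show ?thesis using k by (auto simp: Const_def lookup_single when_def)
  next
    case False
    obtain k' :: 'k where "\<And>f. Poly_Mapping.lookup (partial_pow \<beta> f) \<gamma> = k' * Poly_Mapping.lookup f (\<gamma> + \<beta>)"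
      using lookup_partial_pow by blast
    then show ?thesis using False shift[of \<gamma>] by (auto simp: Const_def lookup_single when_def)
  qed
  then show ?thesis using k(1) by (intro exI[of _ k]) (auto intro: poly_mapping_eqI)
qed

lemma monomial_eq_prod_linear_forms:
  "\<exists>cs. length cs = mdeg \<alpha> \<and>
     (Poly_Mapping.single \<alpha> 1 :: ('k::field_char_0, 'n::finite) mpoly) = prod_list (map linear_form cs)"
proof (induction \<alpha> rule: exponent_induct)
  case 0
  show ?case by (intro exI[of _ "[]"]) (simp add: mdeg_def)
next
  case (Suc \<alpha> i)
  then obtain cs :: "('k^'n) list" where cs: "length cs = mdeg \<alpha>"
    "(Poly_Mapping.single \<alpha> 1 :: ('k, 'n) mpoly) = prod_list (map linear_form cs)" by blast
  have "linear_form (axis i 1) = (Var i :: ('k, 'n) mpoly)"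
  proof (rule mpoly_eqI)
    fix x :: "'k^'n"
    have "dotp (axis i 1) x = (\<Sum>j\<in>UNIV. if j = i then x $ j else 0)"
      unfolding dotp_def by (intro sum.cong) (auto simp: axis_def)
    then show "mpoly_eval x (linear_form (axis i 1)) = mpoly_eval x (Var i)"
      by (simp add: mpoly_eval_linear_form mpoly_eval_Var)
  qed
  moreover have "(Poly_Mapping.single (\<alpha> + Poly_Mapping.single i 1) 1 :: ('k, 'n) mpoly) = Var i * Poly_Mapping.single \<alpha> 1"
    by (simp add: Var_def mult_single add.commute)
  ultimately show ?case
    using cs by (intro exI[of _ "axis i 1 # cs"]) (simp add: mdeg_add mdeg_single)
qed

lemma hom_op_eq_0_if_kills_forms:
  fixes \<theta> :: "('k::field_char_0, 'n::finite) mop"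
  assumes "\<theta> \<in> hom_ops m"
    and "\<And>cs. length cs = m \<Longrightarrow> \<theta> (prod_list (map linear_form cs)) = 0"
  shows "\<theta> = 0"
proof -
  obtain c where \<theta>: "\<theta> = (\<lambda>f. \<Sum>\<alpha> | mdeg \<alpha> = m. c \<alpha> * partial_pow \<alpha> f)"
    using assms(1) by (rule hom_opsE)
  have "c \<alpha> = 0" if \<alpha>: "mdeg \<alpha> = m" for \<alpha>
  proof -
    obtain k :: 'k where k: "k \<noteq> 0" "partial_pow \<alpha> (Poly_Mapping.single \<alpha> 1) = Const k"
      using partial_pow_monomial[of \<alpha> \<alpha>] by auto
    have "\<theta> (Poly_Mapping.single \<alpha> 1) = 0"
      using monomial_eq_prod_linear_forms[of \<alpha>] assms(2) \<alpha> by metis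
    moreover have "\<theta> (Poly_Mapping.single \<alpha> 1) = (\<Sum>\<beta>\<in>{\<alpha>}. c \<beta> * partial_pow \<beta> (Poly_Mapping.single \<alpha> 1))"
      unfolding \<theta>
    proof (intro sum.mono_neutral_right ballI)
      fix \<beta> assume "\<beta> \<in> {\<alpha>. mdeg \<alpha> = m} - {\<alpha>}"
      then show "c \<beta> * partial_pow \<beta> (Poly_Mapping.single \<alpha> 1) = 0"
        using partial_pow_monomial[of \<alpha> \<beta>, where 'k = 'k] \<alpha> by auto
    qed (use \<alpha> in \<open>auto simp: finite_mdeg_eq\<close>)
    ultimately have "Const k * c \<alpha> = 0" using k by (simp add: mult.commute)
    then show ?thesis using k(1) Const_cancel by blast
  qed
  then show ?thesis unfolding \<theta> by (auto simp: fun_eq_iff)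
qed

lemma partial_power_mult: "\<exists>h. partial i (w ^ Suc k * g) = w ^ k * h"
proof -
  have "\<exists>h. partial i (w ^ Suc k) = w ^ k * h"
  proof (induction k)
    case 0
    then show ?case by simp
  next
    case (Suc k)
    then obtain h where h: "partial i (w ^ Suc k) = w ^ k * h" by blast
    have "partial i (w ^ Suc (Suc k)) = w ^ Suc k * (partial i w + h)"
      unfolding power_Suc[of w "Suc k"] partial_mult h by (simp add: algebra_simps)
    then show ?case by blast
  qed
  then obtain h where h: "partial i (w ^ Suc k) = w ^ k * h" by blast
  have "partial i (w ^ Suc k * g) = w ^ k * (h * g + w * partial i g)"
    unfolding partial_mult h by (simp add: algebra_simps)
  then show ?thesis by blast
qed

lemma partial_pow_power_mult: "\<exists>h. partial_pow \<alpha> (w ^ (k + mdeg \<alpha>) * g) = w ^ k * h"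
proof (induction \<alpha> arbitrary: k rule: exponent_induct)
  case 0
  show ?case by (intro exI[of _ g]) (simp add: partial_pow_0 mdeg_def)
next
  case (Suc \<alpha> i)
  obtain h where h: "partial_pow \<alpha> (w ^ (Suc k + mdeg \<alpha>) * g) = w ^ Suc k * h" using Suc by blast
  obtain h' where h': "partial i (w ^ Suc k * h) = w ^ k * h'" using partial_power_mult by blast
  have "k + mdeg (\<alpha> + Poly_Mapping.single i 1) = Suc k + mdeg \<alpha>" by (simp add: mdeg_add mdeg_single)
  then have "partial_pow (\<alpha> + Poly_Mapping.single i 1) (w ^ (k + mdeg (\<alpha> + Poly_Mapping.single i 1)) * g) = w ^ k * h'"
    by (simp only: partial_pow_add_single comp_apply h h')
  then show ?case by blast
qed

text \<open>
  An operator of order \<open>m\<close> does not see polynomials that vanish to order \<open>m + 1\<close> at a point; this is applied to a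
  polynomial \<open>w\<close> vanishing at that point.
\<close>

lemma hom_op_power_mult:
  assumes "\<theta> \<in> hom_ops m"
  shows "\<exists>h. \<theta> (w ^ Suc m * g) = w * h"
proof -
  obtain c where \<theta>: "\<theta> = (\<lambda>f. \<Sum>\<alpha> | mdeg \<alpha> = m. c \<alpha> * partial_pow \<alpha> f)"
    using assms by (rule hom_opsE)
  have "\<exists>h. partial_pow \<alpha> (w ^ Suc m * g) = w * h" if "mdeg \<alpha> = m" for \<alpha>
    using partial_pow_power_mult[of \<alpha> w 1 g] that by simp
  then obtain h where h: "\<And>\<alpha>. mdeg \<alpha> = m \<Longrightarrow> partial_pow \<alpha> (w ^ Suc m * g) = w * h \<alpha>" by metis
  have "\<theta> (w ^ Suc m * g) = (\<Sum>\<alpha> | mdeg \<alpha> = m. c \<alpha> * (w * h \<alpha>))"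
    unfolding \<theta> by (intro sum.cong) (auto simp only: h mem_Collect_eq)
  also have "\<dots> = w * (\<Sum>\<alpha> | mdeg \<alpha> = m. c \<alpha> * h \<alpha>)"
    by (simp add: sum_distrib_left mult_ac)
  finally show ?thesis by blast
qed

definition deriv_along :: "('k::field_char_0)^('n::finite) \<Rightarrow> ('k, 'n) mop" where
  "deriv_along c f = (\<Sum>i\<in>UNIV. Const (c $ i) * partial i f)"

lemma const_derivs_eq: "const_derivs = range deriv_along"
proof -
  have "(\<Sum>i\<in>UNIV. op_scale (Const (c $ i)) (partial i)) = deriv_along c" for c :: "'k::field_char_0^'n::finite"
    by (simp add: fun_eq_iff sum_op_apply op_scale_def deriv_along_def)
  then show ?thesis unfolding const_derivs_def by auto
qed

lemma deriv_along_mult: "deriv_along c (f * g) = deriv_along c f * g + f * deriv_along c g"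
  by (simp add: deriv_along_def partial_mult sum_distrib_left sum_distrib_right sum.distrib
      distrib_left mult_ac)

lemma deriv_along_linear_form: "deriv_along c (linear_form a) = Const (dotp a c)"
  by (rule mpoly_eqI)
    (simp add: deriv_along_def partial_linear_form mpoly_eval_simps dotp_def mult.commute)

lemma const_linear_deriv_along: "const_linear (deriv_along c)"
  by (simp add: const_linear_def deriv_along_def partial_add partial_Const_mult distrib_left
      sum.distrib sum_distrib_left mult.left_commute)

lemma const_linear_funpow: "const_linear \<theta> \<Longrightarrow> const_linear (\<theta> ^^ k)"
  by (induction k) (simp_all add: const_linear_def)

lemma derivation_prod:
  fixes D :: "('k::field_char_0, 'n::finite) mop"
  assumes "\<And>f g. D (f * g) = D f * g + f * D g" "D 1 = 0" "finite R"
  shows "D (\<Prod>K\<in>R. f K) = (\<Sum>K\<in>R. D (f K) * (\<Prod>L\<in>R - {K}. f L))"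
  using assms(3)
proof (induction R)
  case empty
  then show ?case using assms by simp
next
  case (insert H R)
  have "f H * (D (f K) * (\<Prod>L\<in>R - {K}. f L)) = D (f K) * (\<Prod>L\<in>insert H R - {K}. f L)" if "K \<in> R" for K
  proof -
    have "insert H R - {K} = insert H (R - {K})" using that insert.hyps by auto
    then show ?thesis using insert.hyps by (simp add: mult_ac)
  qed
  then have "f H * D (\<Prod>K\<in>R. f K) = (\<Sum>K\<in>R. D (f K) * (\<Prod>L\<in>insert H R - {K}. f L))"
    unfolding insert.IH sum_distrib_left by (rule sum.cong[OF refl])
  then show ?case using insert.hyps by (simp add: assms(1))
qed

lemma deriv_along_1: "deriv_along c 1 = 0"
  by (simp add: deriv_along_def partial_1)

text \<open>
  Each of the derivatives must hit a different factor, and this can happen in \<open>m!\<close> orders.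
\<close>

lemma deriv_along_pow_prod:
  assumes "finite R"
  shows "(deriv_along c ^^ card R) (\<Prod>K\<in>R. linear_form (a K)) = Const (fact (card R) * (\<Prod>K\<in>R. dotp (a K) c))"
  using assms
proof (induction "card R" arbitrary: R)
  case 0
  then show ?case by (simp add: Const_1)
next
  case (Suc k)
  have lin: "const_linear (deriv_along c ^^ k)" by (intro const_linear_funpow const_linear_deriv_along)
  have "(deriv_along c ^^ card R) (\<Prod>K\<in>R. linear_form (a K)) =
      (deriv_along c ^^ k) (deriv_along c (\<Prod>K\<in>R. linear_form (a K)))"
    unfolding Suc.hyps(2)[symmetric] funpow_Suc_right by simp
  also have "deriv_along c (\<Prod>K\<in>R. linear_form (a K)) =
      (\<Sum>K\<in>R. Const (dotp (a K) c) * (\<Prod>L\<in>R - {K}. linear_form (a L)))"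
    using derivation_prod[of "deriv_along c", OF deriv_along_mult deriv_along_1 Suc.prems] by (simp add: deriv_along_linear_form)
  also have "(deriv_along c ^^ k) \<dots> =
      (\<Sum>K\<in>R. Const (dotp (a K) c) * (deriv_along c ^^ k) (\<Prod>L\<in>R - {K}. linear_form (a L)))"
    by (simp add: const_linear_sum[OF lin] const_linear_scale[OF lin])
  also have "\<dots> = (\<Sum>K\<in>R. Const (fact k * (\<Prod>K\<in>R. dotp (a K) c)))"
  proof (rule sum.cong[OF refl])
    fix K assume K: "K \<in> R"
    then have k: "k = card (R - {K})" using Suc by simp
    have "(deriv_along c ^^ k) (\<Prod>L\<in>R - {K}. linear_form (a L)) = Const (fact k * (\<Prod>L\<in>R - {K}. dotp (a L) c))"
      using Suc.hyps(1)[OF k] Suc.prems k by simp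
    then show "Const (dotp (a K) c) * (deriv_along c ^^ k) (\<Prod>L\<in>R - {K}. linear_form (a L)) =
        Const (fact k * (\<Prod>K\<in>R. dotp (a K) c))"
      using prod.remove[OF Suc.prems K, of "\<lambda>K. dotp (a K) c"] by (simp add: Const_mult mult_ac)
  qed
  also have "\<dots> = Const (fact (card R) * (\<Prod>K\<in>R. dotp (a K) c))"
    by (simp add: Const_of_nat[symmetric] Const_mult[symmetric] mult.assoc
        Suc.hyps(2)[symmetric] del: of_nat_Suc)
  finally show ?case .
qed

lemma deriv_along_pow_killed:
  assumes "deriv_along c q = 0"
  shows "(deriv_along c ^^ k) (q * f) = q * (deriv_along c ^^ k) f"
  by (induction k) (simp_all add: deriv_along_mult assms)

lemma deriv_along_pow_hom_ops: "deriv_along c ^^ m \<in> hom_ops m"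
proof (induction m)
  case 0
  have "partial_pow 0 \<in> hom_ops 0"
    unfolding hom_ops_def by (intro ops.span_base) (auto simp: mdeg_def)
  then show ?case by (simp add: partial_pow_0 id_def)
next
  case (Suc m)
  obtain b where b: "deriv_along c ^^ m = (\<lambda>f. \<Sum>\<alpha> | mdeg \<alpha> = m. b \<alpha> * partial_pow \<alpha> f)"
    using Suc by (rule hom_opsE)
  have "deriv_along c ^^ Suc m = (\<Sum>\<alpha> | mdeg \<alpha> = m. \<Sum>i\<in>UNIV.
      op_scale (b \<alpha> * Const (c $ i)) (partial_pow (\<alpha> + Poly_Mapping.single i 1)))"
    unfolding funpow_Suc_right b
    by (simp add: fun_eq_iff sum_op_apply op_scale_def deriv_along_def const_linear_sum[OF const_linear_partial_pow]
        const_linear_scale[OF const_linear_partial_pow] partial_pow_partial sum_distrib_left mult.assoc)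
  also have "\<dots> \<in> hom_ops (Suc m)"
    unfolding hom_ops_def
    by (intro ops.span_sum ops.span_scale ops.span_base) (auto simp: mdeg_add mdeg_single)
  finally show ?case .
qed

section \<open>Membership in the Weyl algebra\<close>

lemma weyl_scale: "\<theta> \<in> weyl_algebra \<Longrightarrow> op_scale s \<theta> \<in> weyl_algebra"
  using weyl_algebra.comp[OF weyl_algebra.mult[of s], of \<theta>] by (simp add: op_scale_def comp_def)

lemma weyl_0: "(0 :: ('k::field_char_0, 'n::finite) mop) \<in> weyl_algebra"
proof -
  have "(\<lambda>f. 0 * f) = (0 :: ('k, 'n) mop)" by (simp add: fun_eq_iff)
  then show ?thesis using weyl_algebra.mult by metis
qed

lemma weyl_id: "(id :: ('k::field_char_0, 'n::finite) mop) \<in> weyl_algebra"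
proof -
  have "(\<lambda>f. 1 * f) = (id :: ('k, 'n) mop)" by (simp add: fun_eq_iff)
  then show ?thesis using weyl_algebra.mult by metis
qed

lemma weyl_sum: "(\<And>i. i \<in> I \<Longrightarrow> F i \<in> weyl_algebra) \<Longrightarrow> (\<Sum>i\<in>I. F i) \<in> weyl_algebra"
  by (induction I rule: infinite_finite_induct) (simp_all add: weyl_0 weyl_algebra.add)

lemma weyl_funpow: "\<theta> \<in> weyl_algebra \<Longrightarrow> \<theta> ^^ k \<in> weyl_algebra"
  by (induction k) (simp_all only: funpow.simps weyl_id weyl_algebra.comp)

lemma weyl_const_derivs: "\<delta> \<in> const_derivs \<Longrightarrow> \<delta> \<in> weyl_algebra"
  unfolding const_derivs_def by (auto intro!: weyl_sum weyl_scale weyl_algebra.partial)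

lemma weyl_partial_pow: "partial_pow \<alpha> \<in> weyl_algebra"
proof (induction \<alpha> rule: exponent_induct)
  case 0
  show ?case unfolding partial_pow_0 by (rule weyl_id)
next
  case (Suc \<alpha> i)
  show ?case unfolding partial_pow_add_single by (intro weyl_algebra.comp weyl_algebra.partial Suc)
qed

lemma weyl_euler_op: "euler_op m \<in> weyl_algebra"
  unfolding euler_op_def by (intro weyl_sum weyl_scale weyl_partial_pow)

lemma hom_ops_euler_op: "euler_op m \<in> hom_ops m"
  unfolding euler_op_def hom_ops_def by (intro ops.span_sum ops.span_scale ops.span_base) auto

section \<open>The Euler operators\<close>

definition euler_field :: "('k::field_char_0, 'n::finite) mop" where
  "euler_field f = (\<Sum>i\<in>UNIV. Var i * partial i f)"

lemma euler_field_mult: "euler_field (f * g) = euler_field f * g + f * euler_field g"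
  by (simp add: euler_field_def partial_mult sum_distrib_left sum_distrib_right sum.distrib
      distrib_left mult_ac)

lemma euler_field_1: "euler_field 1 = 0"
  by (simp add: euler_field_def partial_1)

lemma euler_field_linear_form: "euler_field (linear_form a) = linear_form a"
  unfolding euler_field_def partial_linear_form by (simp add: linear_form_def mult.commute)

lemma const_linear_euler_field: "const_linear euler_field"
  by (simp add: const_linear_def euler_field_def partial_add partial_Const_mult distrib_left
      sum.distrib sum_distrib_left mult.left_commute)

lemma euler_field_prod_linear_forms:
  fixes a :: "'i \<Rightarrow> 'k::field_char_0^'n::finite"
  assumes "finite R"
  shows "euler_field (\<Prod>K\<in>R. linear_form (a K)) = of_nat (card R) * (\<Prod>K\<in>R. linear_form (a K))"
proof -
  have "euler_field (\<Prod>K\<in>R. linear_form (a K)) =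
      (\<Sum>K\<in>R. linear_form (a K) * (\<Prod>L\<in>R - {K}. linear_form (a L)))"
    using derivation_prod[of "euler_field :: ('k, 'n) mop", OF euler_field_mult euler_field_1 assms]
    by (simp add: euler_field_linear_form)
  also have "\<dots> = (\<Sum>K\<in>R. \<Prod>L\<in>R. linear_form (a L))"
    by (intro sum.cong refl prod.remove[symmetric] assms)
  finally show ?thesis by simp
qed

definition multinomial :: "nat \<Rightarrow> ('n::finite \<Rightarrow>\<^sub>0 nat) \<Rightarrow> 'k::field_char_0" where
  "multinomial m \<alpha> = fact m / (\<Prod>i\<in>UNIV. fact (Poly_Mapping.lookup \<alpha> i))"

definition euler_term :: "('n::finite \<Rightarrow>\<^sub>0 nat) \<Rightarrow> ('k::field_char_0, 'n) mop" where
  "euler_term \<alpha> f = Poly_Mapping.single \<alpha> 1 * partial_pow \<alpha> f"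

lemma euler_op_apply:
  "euler_op m f = (\<Sum>\<alpha> | mdeg \<alpha> = m. Const (multinomial m \<alpha>) * euler_term \<alpha> f)"
  by (simp add: euler_op_def sum_op_apply op_scale_def multinomial_def euler_term_def mult.assoc)

lemma prod_fact_add_single:
  "(\<Prod>j\<in>UNIV. fact (Poly_Mapping.lookup (\<alpha> + Poly_Mapping.single i 1) j) :: 'k::field_char_0) =
     of_nat (Suc (Poly_Mapping.lookup \<alpha> i)) * (\<Prod>j\<in>UNIV. fact (Poly_Mapping.lookup \<alpha> (j :: 'n::finite)))"
proof -
  have "(\<Prod>j\<in>UNIV - {i}. fact (Poly_Mapping.lookup (\<alpha> + Poly_Mapping.single i 1) j) :: 'k) =
      (\<Prod>j\<in>UNIV - {i}. fact (Poly_Mapping.lookup \<alpha> j))"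
    by (intro prod.cong) (auto simp: lookup_add lookup_single)
  then show ?thesis
    by (simp add: prod.remove[of UNIV i] lookup_add mult.assoc)
qed

lemma multinomial_add_single:
  "of_nat (Suc m) * (of_nat (Suc (Poly_Mapping.lookup \<alpha> i)) * multinomial m (\<alpha> + Poly_Mapping.single i 1)) =
     (of_nat (Suc m) * multinomial m \<alpha> :: 'k::field_char_0)"
  unfolding multinomial_def prod_fact_add_single by (simp add: field_simps del: of_nat_Suc)

lemma multinomial_Suc:
  fixes \<beta> :: "'n::finite \<Rightarrow>\<^sub>0 nat"
  assumes "mdeg \<beta> = Suc m"
  shows "(multinomial (Suc m) \<beta> :: 'k::field_char_0) =
    (\<Sum>i\<in>UNIV. if Poly_Mapping.lookup \<beta> i = 0 then 0 else multinomial m (\<beta> - Poly_Mapping.single i 1))"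
proof -
  have 1: "(if Poly_Mapping.lookup \<beta> i = 0 then 0 else multinomial m (\<beta> - Poly_Mapping.single i 1)) =
      (of_nat (Poly_Mapping.lookup \<beta> i) * multinomial m \<beta> :: 'k)" for i
  proof (cases "Poly_Mapping.lookup \<beta> i = 0")
    case False
    then have eq: "\<beta> - Poly_Mapping.single i 1 + Poly_Mapping.single i 1 = \<beta>"
      by (rule exponent_diff_add)
    have "Suc (Poly_Mapping.lookup (\<beta> - Poly_Mapping.single i 1) i) = Poly_Mapping.lookup \<beta> i"
      using False by (simp add: lookup_minus)
    then show ?thesis
      using False multinomial_add_single[of m "\<beta> - Poly_Mapping.single i 1" i, where 'k = 'k]
      unfolding eq by (simp del: of_nat_Suc)
  qed simp
  have "(\<Sum>i\<in>UNIV. of_nat (Poly_Mapping.lookup \<beta> i) * multinomial m \<beta>) = (of_nat (mdeg \<beta>) * multinomial m \<beta> :: 'k)"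
    by (simp add: mdeg_def sum_distrib_right)
  also have "\<dots> = multinomial (Suc m) \<beta>"
    by (simp add: assms multinomial_def)
  finally show ?thesis unfolding 1 by simp
qed

lemma euler_field_euler_term:
  "euler_field (euler_term \<alpha> f) =
     of_nat (mdeg \<alpha>) * euler_term \<alpha> f + (\<Sum>i\<in>UNIV. euler_term (\<alpha> + Poly_Mapping.single i 1) f)"
proof -
  have 1: "Var i * partial i (Poly_Mapping.single \<alpha> 1) = of_nat (Poly_Mapping.lookup \<alpha> i) * Poly_Mapping.single \<alpha> (1::'k::field_char_0)" for i
  proof (cases "Poly_Mapping.lookup \<alpha> i = 0")
    case True
    then show ?thesis by (simp add: partial_single)
  next
    case False
    then show ?thesis
      using exponent_diff_add[OF False]
      by (simp add: partial_single Var_def mult_single add.commute single_of_nat[symmetric] del: single_of_nat)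
  qed
  have 2: "Var i * (Poly_Mapping.single \<alpha> 1 * partial i (partial_pow \<alpha> f)) = euler_term (\<alpha> + Poly_Mapping.single i 1) f" for i
    unfolding euler_term_def partial_pow_add_single
    by (simp add: Var_def mult_single mult.assoc[symmetric] add.commute)
  have "euler_field (euler_term \<alpha> f) =
      (\<Sum>i\<in>UNIV. of_nat (Poly_Mapping.lookup \<alpha> i) * euler_term \<alpha> f + euler_term (\<alpha> + Poly_Mapping.single i 1) f)"
    unfolding euler_field_def
  proof (rule sum.cong[OF refl])
    fix i
    have "Var i * partial i (euler_term \<alpha> f) =
      (Var i * partial i (Poly_Mapping.single \<alpha> 1)) * partial_pow \<alpha> f + Var i * (Poly_Mapping.single \<alpha> 1 * partial i (partial_pow \<alpha> f))"
      unfolding euler_term_def partial_mult by (simp add: distrib_left mult.assoc)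
    then show "Var i * partial i (euler_term \<alpha> f) =
      of_nat (Poly_Mapping.lookup \<alpha> i) * euler_term \<alpha> f + euler_term (\<alpha> + Poly_Mapping.single i 1) f"
      unfolding 1 2 by (simp add: euler_term_def mult.assoc)
  qed
  also have "\<dots> = of_nat (mdeg \<alpha>) * euler_term \<alpha> f + (\<Sum>i\<in>UNIV. euler_term (\<alpha> + Poly_Mapping.single i 1) f)"
    by (simp add: sum.distrib mdeg_def sum_distrib_right)
  finally show ?thesis .
qed

text \<open>
  With \<open>E = \<Sum>x\<^sub>i \<partial>\<^sub>i\<close> this reads \<open>\<epsilon>\<^bsub>m+1\<^esub> = (E - m) \<epsilon>\<^sub>m\<close>. It reduces all properties of \<open>\<epsilon>\<^sub>m\<close> that matter
  here to the derivation \<open>E\<close>: on its eigenvectors \<open>\<epsilon>\<^sub>m\<close> acts as a falling factorial, and an ideal generated by an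
  eigenvector is preserved.
\<close>

lemma euler_op_Suc:
  "euler_op (Suc m) f = euler_field (euler_op m f) - of_nat m * euler_op m (f :: ('k::field_char_0, 'n::finite) mpoly)"
proof -
  let ?c = "\<lambda>\<alpha> :: 'n \<Rightarrow>\<^sub>0 nat. Const (multinomial m \<alpha>) :: ('k, 'n) mpoly"
  let ?e = "\<lambda>i :: 'n. Poly_Mapping.single i (1::nat)"
  let ?X = "\<lambda>\<alpha>. euler_term \<alpha> f"
  have lin: "const_linear (euler_field :: ('k, 'n) mop)" by (rule const_linear_euler_field)
  have "euler_field (euler_op m f) =
      (\<Sum>\<alpha> | mdeg \<alpha> = m. ?c \<alpha> * (of_nat (mdeg \<alpha>) * ?X \<alpha> + (\<Sum>i\<in>UNIV. ?X (\<alpha> + ?e i))))"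
    by (simp add: euler_op_apply const_linear_sum[OF lin] const_linear_scale[OF lin] euler_field_euler_term)
  also have "\<dots> = (\<Sum>\<alpha> | mdeg \<alpha> = m. of_nat m * (?c \<alpha> * ?X \<alpha>)) + (\<Sum>\<alpha> | mdeg \<alpha> = m. \<Sum>i\<in>UNIV. ?c \<alpha> * ?X (\<alpha> + ?e i))"
    by (simp add: distrib_left sum.distrib sum_distrib_left mult.left_commute)
  also have "(\<Sum>\<alpha> | mdeg \<alpha> = m. of_nat m * (?c \<alpha> * ?X \<alpha>)) = of_nat m * euler_op m f"
    by (simp add: euler_op_apply sum_distrib_left)
  also have "(\<Sum>\<alpha> | mdeg \<alpha> = m. \<Sum>i\<in>UNIV. ?c \<alpha> * ?X (\<alpha> + ?e i)) =
      (\<Sum>i\<in>UNIV. \<Sum>\<alpha> | mdeg \<alpha> = m. ?c \<alpha> * ?X (\<alpha> + ?e i))"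
    by (rule sum.swap)
  also have "\<dots> = (\<Sum>i\<in>UNIV. \<Sum>\<beta> | mdeg \<beta> = Suc m. if Poly_Mapping.lookup \<beta> i = 0 then 0 else ?c (\<beta> - ?e i) * ?X \<beta>)"
  proof (rule sum.cong[OF refl])
    fix i :: 'n
    have "(\<Sum>\<beta> | mdeg \<beta> = Suc m. if Poly_Mapping.lookup \<beta> i = 0 then 0 else ?c (\<beta> - ?e i) * ?X \<beta>) =
        (\<Sum>\<beta> | mdeg \<beta> = Suc m \<and> Poly_Mapping.lookup \<beta> i \<noteq> 0. ?c (\<beta> - ?e i) * ?X \<beta>)"
      by (rule sum.mono_neutral_cong_right) (auto simp: finite_mdeg_eq)
    also have "\<dots> = (\<Sum>\<alpha> | mdeg \<alpha> = m. ?c \<alpha> * ?X (\<alpha> + ?e i))"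
    proof (rule sum.reindex_bij_witness[of _ "\<lambda>\<alpha>. \<alpha> + ?e i" "\<lambda>\<beta>. \<beta> - ?e i"])
      fix \<beta> assume "\<beta> \<in> {\<beta>. mdeg \<beta> = Suc m \<and> Poly_Mapping.lookup \<beta> i \<noteq> 0}"
      then have *: "\<beta> - ?e i + ?e i = \<beta>" "mdeg \<beta> = Suc m" using exponent_diff_add[of \<beta> i] by auto
      then show "\<beta> - ?e i + ?e i = \<beta>" by simp
      have "mdeg (\<beta> - ?e i) + 1 = mdeg \<beta>" using * mdeg_add[of "\<beta> - ?e i" "?e i"] mdeg_single[of i 1] by metis
      then show "\<beta> - ?e i \<in> {\<alpha>. mdeg \<alpha> = m}" using * by simp
      show "?c (\<beta> - ?e i) * ?X (\<beta> - ?e i + ?e i) = ?c (\<beta> - ?e i) * ?X \<beta>" using * by simp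
    qed (auto simp: mdeg_add mdeg_single lookup_add)
    finally show "(\<Sum>\<alpha> | mdeg \<alpha> = m. ?c \<alpha> * ?X (\<alpha> + ?e i)) =
      (\<Sum>\<beta> | mdeg \<beta> = Suc m. if Poly_Mapping.lookup \<beta> i = 0 then 0 else ?c (\<beta> - ?e i) * ?X \<beta>)" by simp
  qed
  also have "\<dots> = (\<Sum>\<beta> | mdeg \<beta> = Suc m. \<Sum>i\<in>UNIV. if Poly_Mapping.lookup \<beta> i = 0 then 0 else ?c (\<beta> - ?e i) * ?X \<beta>)"
    by (rule sum.swap)
  also have "\<dots> = euler_op (Suc m) f"
    unfolding euler_op_apply
  proof (rule sum.cong[OF refl])
    fix \<beta> :: "'n \<Rightarrow>\<^sub>0 nat" assume "\<beta> \<in> {\<beta>. mdeg \<beta> = Suc m}"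
    then have m: "(multinomial (Suc m) \<beta> :: 'k) =
      (\<Sum>i\<in>UNIV. if Poly_Mapping.lookup \<beta> i = 0 then 0 else multinomial m (\<beta> - ?e i))"
      using multinomial_Suc by blast
    have C: "(Const (\<Sum>i\<in>UNIV. g i) :: ('k, 'n) mpoly) = (\<Sum>i\<in>UNIV. Const (g i))" for g :: "'n \<Rightarrow> 'k"
      by (rule mpoly_eqI) (simp add: mpoly_eval_simps)
    show "(\<Sum>i\<in>UNIV. if Poly_Mapping.lookup \<beta> i = 0 then 0 else ?c (\<beta> - ?e i) * ?X \<beta>) =
        Const (multinomial (Suc m) \<beta>) * ?X \<beta>"
      unfolding m C sum_distrib_right by (intro sum.cong) (auto simp: Const_0)
  qed
  finally show ?thesis by (simp add: algebra_simps)
qed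

lemma euler_op_0: "euler_op 0 f = (f :: ('k::field_char_0, 'n::finite) mpoly)"
proof -
  have "{\<alpha> :: 'n \<Rightarrow>\<^sub>0 nat. mdeg \<alpha> = 0} = {0}" by (auto simp: mdeg_eq_0_iff)
  then show ?thesis
    by (simp add: euler_op_apply multinomial_def euler_term_def partial_pow_0 Const_1)
qed

lemma euler_op_eigen:
  fixes f :: "('k::field_char_0, 'n::finite) mpoly"
  assumes "euler_field f = of_nat d * f"
  shows "euler_op m f = Const (\<Prod>j<m. of_nat d - of_nat j) * f"
proof (induction m)
  case 0
  show ?case by (simp add: euler_op_0 Const_1)
next
  case (Suc m)
  let ?k = "\<Prod>j<m. of_nat d - of_nat j :: 'k"
  have "euler_op (Suc m) f = Const ?k * (Const (of_nat d) * f) - Const (of_nat m) * (Const ?k * f)"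
    by (simp add: euler_op_Suc Suc const_linear_scale[OF const_linear_euler_field] assms Const_of_nat)
  also have "\<dots> = Const (\<Prod>j<Suc m. of_nat d - of_nat j) * f"
    by (rule mpoly_eqI) (simp add: mpoly_eval_simps algebra_simps)
  finally show ?case .
qed

lemma euler_op_prod_linear_forms:
  assumes "finite R" "card R = m"
  shows "euler_op m (\<Prod>K\<in>R. linear_form (a K) :: ('k::field_char_0, 'n::finite) mpoly) =
    Const (fact m) * (\<Prod>K\<in>R. linear_form (a K))"
proof -
  have "(\<Prod>j<m. of_nat m - of_nat j :: 'k) = (\<Prod>j<m. of_nat (m - j))"
    by (intro prod.cong) (auto simp: of_nat_diff)
  also have "\<dots> = fact m"
    by (simp add: fact_prod_rev atLeast0LessThan)
  finally show ?thesis
    using euler_op_eigen[OF euler_field_prod_linear_forms[OF assms(1)], of m a] assms(2) by simp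
qed

lemma euler_op_preserves_ideal:
  assumes "euler_field q = of_nat d * q"
  shows "\<exists>g. euler_op m (q * f) = q * g"
proof (induction m)
  case 0
  then show ?case by (auto simp: euler_op_0)
next
  case (Suc m)
  then obtain g where g: "euler_op m (q * f) = q * g" by blast
  have "euler_op (Suc m) (q * f) = q * (of_nat d * g + euler_field g - of_nat m * g)"
    unfolding euler_op_Suc g euler_field_mult assms by (simp add: algebra_simps)
  then show ?case by blast
qed

section \<open>Operators preserving the ideal of a generic arrangement\<close>

lemma linear_form_lincomb:
  fixes a :: "'i \<Rightarrow> 'k::field_char_0^'n::finite"
  assumes "\<And>x. dotp c x = (\<Sum>K\<in>T. h K * dotp (a K) x)"
  shows "linear_form c = (\<Sum>K\<in>T. Const (h K) * linear_form (a K))"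
  by (rule mpoly_eqI) (simp add: mpoly_eval_simps mpoly_eval_linear_form assms)

text \<open>
  Products \<open>p\<^sub>R\<close> span the forms of degree \<open>m\<close>: a linear form in a product can be replaced by forms of \<open>A\<close> that do
  not yet occur in it, because at least \<open>n\<close> of them are left.
\<close>

lemma generic_op_eq_0:
  fixes \<theta> :: "('k::field_char_0, 'n::finite) mop"
  assumes gen: "generic_on UNIV a A n v" and card: "n + m \<le> Suc (card A)" and "\<theta> \<in> hom_ops m"
    and zero: "\<And>R. R \<subseteq> A \<Longrightarrow> card R = m \<Longrightarrow> \<theta> (\<Prod>K\<in>R. linear_form (a K)) = 0"
  shows "\<theta> = 0"
proof (rule hom_op_eq_0_if_kills_forms[OF assms(3)])
  have lin: "const_linear \<theta>" by (rule const_linear_hom_ops[OF assms(3)])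
  have fin: "finite A" using gen unfolding generic_on_def by blast
  have *: "\<theta> (prod_list (map linear_form cs) * (\<Prod>K\<in>R. linear_form (a K))) = 0"
    if "R \<subseteq> A" "card R + length cs = m" for R cs
    using that
  proof (induction cs arbitrary: R)
    case Nil
    then show ?case using zero by simp
  next
    case (Cons c cs)
    have finR: "finite R" using Cons.prems fin finite_subset by blast
    have "\<exists>h. \<forall>x\<in>UNIV. dotp c x = (\<Sum>K\<in>A - R. h K * dotp (a K) x)"
    proof (rule form_in_span)
      fix x assume x: "\<forall>K\<in>A - R. dotp (a K) x = 0"
      have "n \<le> card (A - R)" using card Cons.prems finR by (simp add: card_Diff_subset)
      then obtain T where T: "T \<subseteq> A - R" "card T = n" by (meson obtain_subset_with_card_n)
      then have "T \<subseteq> A" "\<forall>K\<in>T. dotp (a K) x = 0" using x by auto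
      then have "x = 0" using gen T(2) unfolding generic_on_def by blast
      then show "dotp c x = 0" by (simp add: dotp_0)
    qed (use fin in auto)
    then obtain h where "\<And>x. dotp c x = (\<Sum>K\<in>A - R. h K * dotp (a K) x)" by blast
    then have "linear_form c = (\<Sum>K\<in>A - R. Const (h K) * linear_form (a K))"
      by (rule linear_form_lincomb)
    then have "prod_list (map linear_form (c # cs)) * (\<Prod>K\<in>R. linear_form (a K)) =
        (\<Sum>K\<in>A - R. Const (h K) * linear_form (a K)) * (prod_list (map linear_form cs) * (\<Prod>K\<in>R. linear_form (a K)))"
      by (simp add: mult.assoc)
    also have "\<dots> =
        (\<Sum>K\<in>A - R. Const (h K) * (prod_list (map linear_form cs) * (\<Prod>K\<in>insert K R. linear_form (a K))))"
      unfolding sum_distrib_right by (intro sum.cong) (auto simp: finR mult_ac)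
    finally have "prod_list (map linear_form (c # cs)) * (\<Prod>K\<in>R. linear_form (a K)) = \<dots>" .
    then have "\<theta> (prod_list (map linear_form (c # cs)) * (\<Prod>K\<in>R. linear_form (a K))) =
        (\<Sum>K\<in>A - R. Const (h K) * \<theta> (prod_list (map linear_form cs) * (\<Prod>K\<in>insert K R. linear_form (a K))))"
      by (simp only: const_linear_sum[OF lin] const_linear_scale[OF lin])
    also have "\<dots> = 0"
    proof (rule sum.neutral, rule ballI)
      fix K assume "K \<in> A - R"
      then have "\<theta> (prod_list (map linear_form cs) * (\<Prod>K\<in>insert K R. linear_form (a K))) = 0"
        using Cons.prems finR by (intro Cons.IH) auto
      then show "Const (h K) * \<theta> (prod_list (map linear_form cs) * (\<Prod>K\<in>insert K R. linear_form (a K))) = 0"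
        by simp
    qed
    finally show ?case .
  qed
  fix cs :: "('k^'n) list" assume "length cs = m"
  then show "\<theta> (prod_list (map linear_form cs)) = 0"
    using *[of "{}" cs] by simp
qed

lemma one_diff_power_dvd: "\<exists>u. (1 - z) ^ k = 1 - z * (u :: 'a::comm_ring_1)"
proof (induction k)
  case 0
  show ?case by (intro exI[of _ 0]) simp
next
  case (Suc k)
  then obtain u where u: "(1 - z) ^ k = 1 - z * u" by blast
  have "(1 - z) ^ Suc k = 1 - z * (1 + u - z * u)"
    by (simp add: u algebra_simps)
  then show ?case by blast
qed

text \<open>
  Let \<open>Q' = Q / p\<^sub>H\<close>. At a point \<open>x\<close> of \<open>H\<close> with \<open>Q' x \<noteq> 0\<close>, the polynomial \<open>p\<^sub>H g\<close> agrees to order \<open>m + 1\<close>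
  with a multiple of \<open>Q\<close>: the factor \<open>1 - z\<close> with \<open>z = Q' / Q' x\<close> vanishes at \<open>x\<close>, and
  \<open>1 - (1 - z)\<^bsup>m+1\<^esup>\<close> is divisible by \<open>z\<close>. So \<open>\<theta> (p\<^sub>H g)\<close> vanishes at \<open>x\<close>, and such points are Zariski dense in \<open>H\<close>.
\<close>

lemma op_preserves_each_hyperplane:
  fixes \<theta> :: "('k::field_char_0, 'n::finite) mop"
  assumes gen: "generic_on UNIV a A n v" and n: "2 \<le> n" "n \<le> card A" and \<theta>: "\<theta> \<in> hom_ops m"
    and ideal: "\<And>f. \<exists>g. \<theta> ((\<Prod>K\<in>A. linear_form (a K)) * f) = (\<Prod>K\<in>A. linear_form (a K)) * g"
    and H: "H \<in> A" and y: "dotp (a H) y = 0"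
  shows "mpoly_eval y (\<theta> (linear_form (a H) * g)) = 0"
proof -
  have fin: "finite A" using gen unfolding generic_on_def by blast
  let ?p = "linear_form (a H)" and ?Q' = "\<Prod>K\<in>A - {H}. linear_form (a K)"
  have lin: "const_linear \<theta>" by (rule const_linear_hom_ops[OF \<theta>])
  have Q: "(\<Prod>K\<in>A. linear_form (a K)) = ?p * ?Q'" by (rule prod.remove[OF fin H])
  have generic_point: "mpoly_eval x (\<theta> (?p * g)) = 0" if x: "dotp (a H) x = 0" "mpoly_eval x ?Q' \<noteq> 0" for x
  proof -
    define z where "z = Const (inverse (mpoly_eval x ?Q')) * ?Q'"
    have z1: "mpoly_eval x z = 1" using x by (simp add: z_def mpoly_eval_simps)
    obtain u where u: "(1 - z) ^ Suc m = 1 - z * u" using one_diff_power_dvd by blast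
    obtain h where h: "\<theta> ((1 - z) ^ Suc m * (?p * g)) = (1 - z) * h" using hom_op_power_mult[OF \<theta>] by blast
    define f where "f = Const (inverse (mpoly_eval x ?Q')) * (u * g)"
    have "(\<Prod>K\<in>A. linear_form (a K)) * f = z * u * (?p * g)"
      unfolding Q f_def z_def by (simp add: mult_ac)
    then have "?p * g = (1 - z) ^ Suc m * (?p * g) + (\<Prod>K\<in>A. linear_form (a K)) * f"
      unfolding u by (simp add: left_diff_distrib)
    then have "\<theta> (?p * g) = (1 - z) * h + \<theta> ((\<Prod>K\<in>A. linear_form (a K)) * f)"
      using const_linear_add[OF lin] h by metis
    moreover obtain g' where "\<theta> ((\<Prod>K\<in>A. linear_form (a K)) * f) = (\<Prod>K\<in>A. linear_form (a K)) * g'"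
      using ideal by blast
    ultimately have "\<theta> (?p * g) = (1 - z) * h + ?p * ?Q' * g'" unfolding Q by simp
    then show ?thesis
      using x(1) z1 by (simp add: mpoly_eval_add mpoly_eval_mult mpoly_eval_diff mpoly_eval_1 mpoly_eval_linear_form)
  qed
  let ?W = "{x \<in> UNIV. dotp (a H) x = 0}"
  have "\<forall>x\<in>?W. mpoly_eval x (\<theta> (?p * g)) = 0"
  proof (rule polyfun_prod_mult_eq_0_on_subspace[of "A - {H}" ?W _ a])
    show "vec.subspace ?W" by (rule subspace_ker) auto
    show "polyfun (\<lambda>x. mpoly_eval x (\<theta> (?p * g)))" by (rule polyfun_mpoly_eval)
    show "\<exists>u\<in>?W. dotp (a K) u \<noteq> 0" if "K \<in> A - {H}" for K
      using generic_on_ex_separating[OF gen n, of K H] that H by auto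
    show "(\<Prod>K\<in>A - {H}. dotp (a K) x) * mpoly_eval x (\<theta> (?p * g)) = 0" if "x \<in> ?W" for x
      using generic_point[of x] that by (auto simp: mpoly_eval_prod mpoly_eval_linear_form)
  qed (use fin in auto)
  then show ?thesis using y by blast
qed

lemma logarithmic_on_op:
  fixes \<theta> :: "('k::field_char_0, 'n::finite) mop"
  assumes gen: "generic_on UNIV a A n v" and n: "2 \<le> n" "n \<le> card A" and \<theta>: "\<theta> \<in> hom_ops m"
    and ideal: "\<And>f. \<exists>g. \<theta> ((\<Prod>K\<in>A. linear_form (a K)) * f) = (\<Prod>K\<in>A. linear_form (a K)) * g"
  shows "logarithmic_on m UNIV a A (\<lambda>R x. mpoly_eval x (\<theta> (\<Prod>K\<in>R. linear_form (a K))))"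
  unfolding logarithmic_on_def
proof (intro allI impI)
  fix R assume R: "R \<subseteq> A" "card R = m"
  have "finite A" using gen unfolding generic_on_def by blast
  then have finR: "finite R" using R finite_subset by blast
  show "\<exists>f. polyfun f \<and> (\<forall>x\<in>UNIV. mpoly_eval x (\<theta> (\<Prod>K\<in>R. linear_form (a K))) = (\<Prod>K\<in>R. dotp (a K) x) * f x)"
  proof (rule polyfun_factor_prod_on_subspace[OF finR vec.subspace_UNIV polyfun_mpoly_eval])
    show "\<exists>u\<in>UNIV. dotp (a K) u \<noteq> 0" if "K \<in> R" for K
      using generic_on_ex_neq_0[OF gen _ n(2), of K] n(1) R that by auto
    show "\<exists>u\<in>UNIV. dotp (a L) u = 0 \<and> dotp (a K) u \<noteq> 0" if "K \<in> R" "L \<in> R" "K \<noteq> L" for K L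
      using generic_on_ex_separating[OF gen n, of K L] R that by auto
    show "mpoly_eval x (\<theta> (\<Prod>K\<in>R. linear_form (a K))) = 0" if "K \<in> R" "dotp (a K) x = 0" for K x
      using op_preserves_each_hyperplane[OF gen n \<theta> ideal, of K x "\<Prod>L\<in>R - {K}. linear_form (a L)"] that R
        prod.remove[OF finR that(1), of "\<lambda>L. linear_form (a L) :: ('k, 'n) mpoly"] by auto
  qed
qed

text \<open>
  A relation between the forms makes the corresponding combination of the products
  \<open>p\<^bsub>insert K U\<^esub>\<close> zero before any operator is applied.
\<close>

lemma multilinear_on_op:
  fixes \<theta> :: "('k::field_char_0, 'n::finite) mop"
  assumes "finite A" and \<theta>: "const_linear \<theta>"
  shows "multilinear_on m UNIV a A (\<lambda>R x. mpoly_eval x (\<theta> (\<Prod>K\<in>R. linear_form (a K))))"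
  unfolding multilinear_on_def
proof (intro allI impI ballI)
  fix U h x
  assume U: "U \<subseteq> A" and h: "\<forall>x\<in>UNIV. (\<Sum>K\<in>A - U. h K * dotp (a K) x) = 0"
  have finU: "finite U" using U assms(1) finite_subset by blast
  have "(\<Sum>K\<in>A - U. Const (h K) * linear_form (a K) :: ('k, 'n) mpoly) = 0"
    using h by (intro mpoly_eqI) (simp add: mpoly_eval_simps mpoly_eval_linear_form)
  then have "\<theta> ((\<Sum>K\<in>A - U. Const (h K) * linear_form (a K)) * (\<Prod>K\<in>U. linear_form (a K))) = 0"
    using const_linear_0[OF \<theta>] by simp
  moreover have "(\<Sum>K\<in>A - U. Const (h K) * linear_form (a K)) * (\<Prod>K\<in>U. linear_form (a K)) =
      (\<Sum>K\<in>A - U. Const (h K) * (\<Prod>L\<in>insert K U. linear_form (a L)))"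
    unfolding sum_distrib_right by (intro sum.cong) (auto simp: finU mult.assoc)
  ultimately have "(\<Sum>K\<in>A - U. Const (h K) * \<theta> (\<Prod>L\<in>insert K U. linear_form (a L))) = 0"
    by (simp only: const_linear_sum[OF \<theta>] const_linear_scale[OF \<theta>])
  then have "mpoly_eval x (\<Sum>K\<in>A - U. Const (h K) * \<theta> (\<Prod>L\<in>insert K U. linear_form (a L))) = 0"
    by (simp add: mpoly_eval_0)
  then show "(\<Sum>K\<in>A - U. h K * mpoly_eval x (\<theta> (\<Prod>K\<in>insert K U. linear_form (a K)))) = 0"
    by (simp add: mpoly_eval_sum mpoly_eval_mult mpoly_eval_Const)
qed

text \<open>
  The coefficient functions found for the table are polynomials, and an operator in \<open>hom_ops m\<close> is determined by
  its table. The factor \<open>1 / m!\<close> compensates for the normalization of \<open>generator\<close>.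
\<close>

lemma log_ops_generated:
  fixes \<theta> :: "('k::field_char_0, 'n::finite) mop" and a :: "'i \<Rightarrow> 'k^'n"
  assumes gen: "generic_on UNIV a A n v" and n: "2 \<le> n" and m: "1 \<le> m" and card: "n + m \<le> Suc (card A)"
    and \<theta>: "\<theta> \<in> hom_ops m"
    and ideal: "\<And>f. \<exists>g. \<theta> ((\<Prod>K\<in>A. linear_form (a K)) * f) = (\<Prod>K\<in>A. linear_form (a K)) * g"
    and R0: "R0 \<subseteq> A" "card R0 = m" "\<theta> (\<Prod>K\<in>R0. linear_form (a K)) = 0"
  shows "\<theta> \<in> ops.span {op_scale (\<Prod>K\<in>A - T. linear_form (a K)) (deriv_along (v T) ^^ m) | T. T \<in> meeting_sets A n R0}"
proof -
  have fin: "finite A" using gen unfolding generic_on_def by blast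
  have nA: "n \<le> card A" using card m by simp
  let ?\<Phi> = "\<lambda>R x. mpoly_eval x (\<theta> (\<Prod>K\<in>R. linear_form (a K)))"
  let ?M = "meeting_sets A n R0"
  let ?G = "\<lambda>T. op_scale (\<Prod>K\<in>A - T. linear_form (a K)) (deriv_along (v T) ^^ m)"
  have "\<exists>g. (\<forall>T. polyfun (g T)) \<and> (\<forall>R. R \<subseteq> A \<longrightarrow> card R = m \<longrightarrow> (\<forall>x\<in>UNIV.
           ?\<Phi> R x = (\<Sum>T\<in>?M. g T x * generator a A T (v T) R x)))"
    using logarithmic_on_op[OF gen n nA \<theta> ideal] multilinear_on_op[OF fin const_linear_hom_ops[OF \<theta>]] n R0
    by (intro logarithmic_multilinear_generated[OF gen _ m card]) (auto simp: polyfun_mpoly_eval mpoly_eval_0)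
  then obtain g where g: "\<And>T. polyfun (g T)"
    "\<And>R x. R \<subseteq> A \<Longrightarrow> card R = m \<Longrightarrow> ?\<Phi> R x = (\<Sum>T\<in>?M. g T x * generator a A T (v T) R x)"
    by blast
  obtain s where s: "\<And>T x. g T x = mpoly_eval x (s T)"
    using polyfun_imp_mpoly_eval[OF g(1)] by metis
  define \<eta> where "\<eta> = (\<Sum>T\<in>?M. op_scale (Const (inverse (fact m)) * s T) (?G T))"
  have "\<eta> \<in> hom_ops m"
    unfolding \<eta>_def hom_ops_def
    by (intro ops.span_sum ops.span_scale deriv_along_pow_hom_ops[unfolded hom_ops_def])
  with \<theta> have "\<theta> - \<eta> \<in> hom_ops m"
    unfolding hom_ops_def by (rule ops.span_diff)
  then have "\<theta> - \<eta> = 0"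
  proof (rule generic_op_eq_0[OF gen card])
    fix R assume R: "R \<subseteq> A" "card R = m"
    have finR: "finite R" using R fin finite_subset by blast
    have "mpoly_eval x (\<eta> (\<Prod>K\<in>R. linear_form (a K))) = ?\<Phi> R x" for x
    proof -
      have "(deriv_along (v T) ^^ m) (\<Prod>K\<in>R. linear_form (a K)) = Const (fact m * (\<Prod>K\<in>R. dotp (a K) (v T)))" for T
        using deriv_along_pow_prod[OF finR, of "v T" a] R(2) by simp
      then have "mpoly_eval x (\<eta> (\<Prod>K\<in>R. linear_form (a K))) =
          (\<Sum>T\<in>?M. inverse (fact m) * mpoly_eval x (s T) *
            ((\<Prod>K\<in>A - T. dotp (a K) x) * (fact m * (\<Prod>K\<in>R. dotp (a K) (v T)))))"
        by (simp add: \<eta>_def sum_op_apply op_scale_def mpoly_eval_simps mpoly_eval_linear_form mult.assoc)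
      also have "\<dots> = (\<Sum>T\<in>?M. g T x * generator a A T (v T) R x)"
        by (intro sum.cong) (auto simp: s generator_def field_simps)
      finally show ?thesis using g(2)[OF R] by simp
    qed
    then have "\<eta> (\<Prod>K\<in>R. linear_form (a K)) = \<theta> (\<Prod>K\<in>R. linear_form (a K))"
      by (rule mpoly_eqI)
    then show "(\<theta> - \<eta>) (\<Prod>K\<in>R. linear_form (a K)) = 0" by simp
  qed
  then have "\<theta> = \<eta>" by simp
  also have "\<eta> \<in> ops.span {?G T | T. T \<in> ?M}"
    unfolding \<eta>_def by (intro ops.span_sum ops.span_scale ops.span_base) auto
  finally show ?thesis .
qed

section \<open>The generic arrangement theorem\<close>

lemma arr_opsD: "\<theta> \<in> arr_ops A p \<Longrightarrow> \<exists>g. \<theta> (arr_poly A p * f) = arr_poly A p * g"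
  unfolding arr_ops_def by blast

lemma arr_opsI:
  "\<theta> \<in> weyl_algebra \<Longrightarrow> (\<And>f. \<exists>g. \<theta> (arr_poly A p * f) = arr_poly A p * g) \<Longrightarrow> \<theta> \<in> arr_ops A p"
  unfolding arr_ops_def by fastforce

lemma subspace_hom_arr_ops: "ops.subspace (hom_arr_ops m A p)"
proof -
  have "ops.subspace (arr_ops A p)"
  proof (rule ops.subspaceI)
    show "0 \<in> arr_ops A p"
      by (rule arr_opsI[OF weyl_0]) (auto intro: exI[of _ 0])
  next
    fix \<theta> \<eta> assume *: "\<theta> \<in> arr_ops A p" "\<eta> \<in> arr_ops A p"
    show "\<theta> + \<eta> \<in> arr_ops A p"
    proof (rule arr_opsI)
      show "\<theta> + \<eta> \<in> weyl_algebra" using * unfolding arr_ops_def by (auto intro: weyl_algebra.add)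
      fix f
      obtain g h where "\<theta> (arr_poly A p * f) = arr_poly A p * g" "\<eta> (arr_poly A p * f) = arr_poly A p * h"
        using arr_opsD * by metis
      then have "(\<theta> + \<eta>) (arr_poly A p * f) = arr_poly A p * (g + h)" by (simp add: distrib_left)
      then show "\<exists>g. (\<theta> + \<eta>) (arr_poly A p * f) = arr_poly A p * g" by blast
    qed
  next
    fix s \<theta> assume *: "\<theta> \<in> arr_ops A p"
    show "op_scale s \<theta> \<in> arr_ops A p"
    proof (rule arr_opsI)
      show "op_scale s \<theta> \<in> weyl_algebra" using * unfolding arr_ops_def by (auto intro: weyl_scale)
      fix f
      obtain g where "\<theta> (arr_poly A p * f) = arr_poly A p * g" using arr_opsD * by metis
      then have "op_scale s \<theta> (arr_poly A p * f) = arr_poly A p * (s * g)"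
        by (simp add: op_scale_def mult.left_commute)
      then show "\<exists>g. op_scale s \<theta> (arr_poly A p * f) = arr_poly A p * g" by blast
    qed
  qed
  then show ?thesis
    unfolding hom_arr_ops_def hom_ops_def by (intro ops.subspace_inter ops.subspace_span)
qed

lemma subspace_Xi_ops: "ops.subspace (Xi_ops m A p Hs)"
proof -
  have "ops.subspace {\<theta>. \<theta> (\<Prod>i=1..m. p (Hs i)) = 0}"
    by (rule ops.subspaceI) (auto simp: op_scale_def)
  moreover have "Xi_ops m A p Hs = hom_arr_ops m A p \<inter> {\<theta>. \<theta> (\<Prod>i=1..m. p (Hs i)) = 0}"
    unfolding Xi_ops_def by blast
  ultimately show ?thesis using subspace_hom_arr_ops ops.subspace_inter by metis
qed

theorem theorem8p3:
  fixes A :: "(('k::field_char_0)^('n::finite)) set set"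
    and p :: "('k^'n) set \<Rightarrow> ('k, 'n) mpoly"
    and \<delta> :: "('k^'n) set set \<Rightarrow> ('k, 'n) mop"
    and r m :: nat
    and Hs :: "nat \<Rightarrow> ('k^'n) set"
  assumes "CARD('n) \<ge> 2"
    and "generic_arrangement A"
    and "card A = r"
    and "r \<ge> CARD('n)"
    and "\<forall>H\<in>A. defining_form (p H) H"
    and "\<forall>T\<in>k_subsets A (CARD('n) - 1). killing_derivation p T (\<delta> T)"
    and "m \<ge> 1"
    and "m < r - CARD('n) + 1"
    and "inj_on Hs {1..m}"
    and "Hs ` {1..m} \<subseteq> A"
  shows "internal_direct_sum (hom_arr_ops m A p) (Xi_ops m A p Hs) (ops.span {euler_op m}) \<and>
    internal_direct_sum (hom_arr_ops m A p) (ops.span (Xi_gens m A p \<delta> Hs)) (ops.span {euler_op m}) \<and>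
    minimal_generators (Xi_gens m A p \<delta> Hs) (Xi_ops m A p Hs)"
proof -
  define n where "n = CARD('n)"
  have n2: "2 \<le> n" and card: "n + m \<le> card A" and nA: "n \<le> card A"
    using assms(1,3,4,8) by (auto simp: n_def)
  have fin: "finite A" using assms(2) unfolding generic_arrangement_def arrangement_def by blast
  obtain a where a: "\<And>H. H \<in> A \<Longrightarrow> p H = linear_form (a H)" "\<And>H x. H \<in> A \<Longrightarrow> x \<in> H \<longleftrightarrow> dotp (a H) x = 0"
  proof -
    have "\<forall>H\<in>A. \<exists>c. p H = linear_form c \<and> (\<forall>x. x \<in> H \<longleftrightarrow> dotp c x = 0)"
    proof
      fix H assume "H \<in> A"
      then have df: "defining_form (p H) H" using assms(5) by blast
      then obtain c where c: "p H = linear_form c" unfolding defining_form_def by blast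
      have "H = {v. mpoly_eval v (p H) = 0}" using df unfolding defining_form_def by blast
      then have "\<forall>x. x \<in> H \<longleftrightarrow> dotp c x = 0" unfolding c mpoly_eval_linear_form by blast
      then show "\<exists>c. p H = linear_form c \<and> (\<forall>x. x \<in> H \<longleftrightarrow> dotp c x = 0)" using c by blast
    qed
    then show thesis using that by metis
  qed
  have p_prod: "(\<Prod>H\<in>R. p H) = (\<Prod>H\<in>R. linear_form (a H))" if "R \<subseteq> A" for R
    using that a(1) by (intro prod.cong) auto
  have Q: "arr_poly A p = (\<Prod>H\<in>A. linear_form (a H))"
    unfolding arr_poly_def by (rule p_prod) simp
  have ksub: "T \<in> k_subsets A (CARD('n) - 1) \<longleftrightarrow> T \<subseteq> A \<and> Suc (card T) = n" for T
    using fin n2 by (auto simp: k_subsets_def n_def intro: finite_subset)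
  have "\<forall>T. \<exists>c. T \<subseteq> A \<and> Suc (card T) = n \<longrightarrow> \<delta> T = deriv_along c \<and> c \<noteq> 0 \<and> (\<forall>K\<in>T. dotp (a K) c = 0)"
  proof
    fix T
    have ex: "\<exists>c. \<delta> T = deriv_along c \<and> c \<noteq> 0 \<and> (\<forall>K\<in>T. dotp (a K) c = 0)" if T: "T \<subseteq> A" "Suc (card T) = n"
    proof -
      have kd: "killing_derivation p T (\<delta> T)" using assms(6) ksub T by blast
      then obtain c where c: "\<delta> T = deriv_along c" unfolding killing_derivation_def const_derivs_eq by blast
      have "c \<noteq> 0"
      proof
        assume "c = 0"
        then have "\<delta> T = 0" unfolding c by (simp add: fun_eq_iff deriv_along_def Const_0)
        then show False using kd unfolding killing_derivation_def by blast
      qed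
      moreover have "dotp (a K) c = 0" if K: "K \<in> T" for K
      proof -
        have "deriv_along c (linear_form (a K)) = 0"
          using kd K unfolding killing_derivation_def c a(1)[OF subsetD[OF T(1) K], symmetric] by blast
        then have "Const (dotp (a K) c) = (0 :: ('k, 'n) mpoly)" unfolding deriv_along_linear_form .
        then show ?thesis by (metis mpoly_eval_Const mpoly_eval_0)
      qed
      ultimately show ?thesis using c by blast
    qed
    show "\<exists>c. T \<subseteq> A \<and> Suc (card T) = n \<longrightarrow> \<delta> T = deriv_along c \<and> c \<noteq> 0 \<and> (\<forall>K\<in>T. dotp (a K) c = 0)"
      using ex by (cases "T \<subseteq> A \<and> Suc (card T) = n", simp, auto)
  qed
  then obtain v where v: "\<And>T. T \<subseteq> A \<Longrightarrow> Suc (card T) = n \<Longrightarrow>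
      \<delta> T = deriv_along (v T) \<and> v T \<noteq> 0 \<and> (\<forall>K\<in>T. dotp (a K) (v T) = 0)"
    by metis
  have gen: "generic_on UNIV a A n v"
    unfolding generic_on_def
  proof (intro conjI allI impI)
    fix T x assume T: "T \<subseteq> A" "card T = n" "\<forall>K\<in>T. dotp (a K) x = 0"
    have "x \<in> \<Inter>T" using T a(2) by auto
    moreover have "\<Inter>T = {0}" using assms(2) T unfolding generic_arrangement_def n_def by blast
    ultimately show "x = 0" by blast
  qed (use fin v in auto)
  define R0 where "R0 = Hs ` {1..m}"
  have R0: "R0 \<subseteq> A" "card R0 = m" using assms(9,10) by (auto simp: R0_def card_image)
  then have finR0: "finite R0" using fin finite_subset by blast
  have prodR0: "(\<Prod>i=1..m. p (Hs i)) = (\<Prod>H\<in>R0. linear_form (a H))"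
    using prod.reindex[OF assms(9), of p] p_prod[OF R0(1)] by (simp add: R0_def)
  let ?q = "\<Prod>H\<in>R0. linear_form (a H) :: ('k, 'n) mpoly"
  let ?G = "\<lambda>T. op_scale (\<Prod>H\<in>A - T. linear_form (a H)) (deriv_along (v T) ^^ m) :: ('k, 'n) mop"
  let ?M = "meeting_sets A n R0"
  have gens: "Xi_gens m A p \<delta> Hs = {?G T | T. T \<in> ?M}"
  proof -
    have eq: "op_scale (\<Prod>H\<in>A - T. p H) (\<delta> T ^^ m) = ?G T" if "T \<in> ?M" for T
      using that v[of T] p_prod[of "A - T"] unfolding meeting_sets_def by auto
    have iff: "T \<in> k_subsets A (CARD('n) - 1) \<and> T \<inter> Hs ` {1..m} \<noteq> {} \<longleftrightarrow> T \<in> ?M" for T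
      unfolding ksub meeting_sets_def R0_def by blast
    show ?thesis
      unfolding Xi_gens_def iff setcompr_eq_image by (rule image_cong[OF refl]) (simp only: eq mem_Collect_eq)
  qed
  have MD: "T \<subseteq> A" "Suc (card T) = n" "T \<inter> R0 \<noteq> {}" if "T \<in> ?M" for T
    using that unfolding meeting_sets_def by auto
  have Xi_iff: "\<theta> \<in> Xi_ops m A p Hs \<longleftrightarrow> \<theta> \<in> hom_arr_ops m A p \<and> \<theta> ?q = 0" for \<theta>
    unfolding Xi_ops_def prodR0 by blast
  have powR: "(deriv_along (v T) ^^ m) (\<Prod>K\<in>R. linear_form (a K)) = Const (fact m * (\<Prod>K\<in>R. dotp (a K) (v T)))"
    if "finite R" "card R = m" for R T
    using deriv_along_pow_prod[OF that(1), of "v T" a] that(2) by simp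
  have gen_in: "?G T \<in> Xi_ops m A p Hs" if T: "T \<in> ?M" for T
  proof -
    note T' = MD[OF T]
    have vT: "dotp (a K) (v T) = 0" if "K \<in> T" for K using v[OF T'(1,2)] that by blast
    have finT: "finite T" using T'(1) fin finite_subset by blast
    have "?G T \<in> arr_ops A p"
    proof (rule arr_opsI)
      show "?G T \<in> weyl_algebra"
        by (intro weyl_scale weyl_funpow weyl_const_derivs) (simp add: const_derivs_eq)
      fix f
      have killed: "deriv_along (v T) (\<Prod>K\<in>T. linear_form (a K)) = 0"
        using derivation_prod[of "deriv_along (v T)", OF deriv_along_mult deriv_along_1 finT, of "\<lambda>K. linear_form (a K)"]
          vT by (simp add: deriv_along_linear_form Const_0)
      have split: "arr_poly A p = (\<Prod>H\<in>A - T. linear_form (a H)) * (\<Prod>K\<in>T. linear_form (a K))"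
        unfolding Q by (rule prod.subset_diff[OF T'(1) fin])
      let ?P = "\<Prod>H\<in>A - T. linear_form (a H)" and ?N = "\<Prod>K\<in>T. linear_form (a K)"
      \<comment> \<open>\<open>\<delta>\<^sub>T\<close> commutes with multiplication by the forms of \<open>T\<close>, which together with \<open>P\<^sub>T\<close> make up \<open>Q\<close>\<close>
      have swap: "arr_poly A p * f = ?N * (?P * f)"
        unfolding split by (simp add: mult_ac)
      have "?G T (arr_poly A p * f) = ?P * (?N * (deriv_along (v T) ^^ m) (?P * f))"
        unfolding swap op_scale_def deriv_along_pow_killed[OF killed] ..
      also have "\<dots> = arr_poly A p * (deriv_along (v T) ^^ m) (?P * f)"
        unfolding split by (simp only: mult.assoc)
      finally have "?G T (arr_poly A p * f) = arr_poly A p * (deriv_along (v T) ^^ m) (?P * f)" .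
      then show "\<exists>g. ?G T (arr_poly A p * f) = arr_poly A p * g" by blast
    qed
    moreover have "?G T \<in> hom_ops m"
      unfolding hom_ops_def by (intro ops.span_scale deriv_along_pow_hom_ops[unfolded hom_ops_def])
    moreover have "?G T ?q = 0"
    proof -
      obtain K where "K \<in> T" "K \<in> R0" using T'(3) by blast
      then have "(\<Prod>K\<in>R0. dotp (a K) (v T)) = 0" using vT finR0 by auto
      then show ?thesis by (simp add: op_scale_def powR[OF finR0 R0(2)] Const_0)
    qed
    ultimately show ?thesis unfolding Xi_iff hom_arr_ops_def by blast
  qed
  have span_eq: "ops.span (Xi_gens m A p \<delta> Hs) = Xi_ops m A p Hs"
  proof
    show "ops.span (Xi_gens m A p \<delta> Hs) \<subseteq> Xi_ops m A p Hs"
      unfolding gens using gen_in by (intro ops.span_minimal subspace_Xi_ops) auto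
    show "Xi_ops m A p Hs \<subseteq> ops.span (Xi_gens m A p \<delta> Hs)"
    proof
      fix \<theta> assume "\<theta> \<in> Xi_ops m A p Hs"
      then have \<theta>: "\<theta> \<in> arr_ops A p" "\<theta> \<in> hom_ops m" "\<theta> ?q = 0"
        unfolding Xi_iff hom_arr_ops_def by auto
      have "n + m \<le> Suc (card A)" using card by simp
      then show "\<theta> \<in> ops.span (Xi_gens m A p \<delta> Hs)"
        unfolding gens
        using arr_opsD[OF \<theta>(1)] by (intro log_ops_generated[OF gen n2 assms(7) _ \<theta>(2) _ R0 \<theta>(3)]) (auto simp: Q)
    qed
  qed
  have "euler_op m \<in> hom_arr_ops m A p"
    unfolding hom_arr_ops_def
    by (intro IntI hom_ops_euler_op arr_opsI weyl_euler_op, unfold Q)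
      (rule euler_op_preserves_ideal[OF euler_field_prod_linear_forms[OF fin]])
  moreover have eq: "euler_op m ?q = Const (fact m) * ?q"
    by (rule euler_op_prod_linear_forms[OF finR0 R0(2)])
  ultimately have euler: "op_scale k (euler_op m) \<in> hom_arr_ops m A p" "op_scale k (euler_op m) ?q = k * Const (fact m) * ?q" for k
    using ops.subspace_scale[OF subspace_hom_arr_ops] by (auto simp: op_scale_def mult.assoc)
  have span_euler: "ops.span {euler_op m} = range (\<lambda>k. op_scale k (euler_op m) :: ('k, 'n) mop)"
    by (rule ops.span_singleton)
  have "hom_arr_ops m A p = {u + w | u w. u \<in> Xi_ops m A p Hs \<and> w \<in> ops.span {euler_op m}}"
  proof (intro equalityI subsetI)
    fix \<theta> assume \<theta>: "\<theta> \<in> hom_arr_ops m A p"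
    then have \<theta>': "\<theta> \<in> arr_ops A p" "\<theta> \<in> hom_ops m" unfolding hom_arr_ops_def by auto
    have "logarithmic_on m UNIV a A (\<lambda>R x. mpoly_eval x (\<theta> (\<Prod>K\<in>R. linear_form (a K))))"
      using arr_opsD[OF \<theta>'(1)] by (intro logarithmic_on_op[OF gen n2 nA \<theta>'(2)]) (auto simp: Q)
    from this[unfolded logarithmic_on_def, rule_format, OF R0]
    obtain f where f: "polyfun f" "\<And>x. mpoly_eval x (\<theta> ?q) = (\<Prod>K\<in>R0. dotp (a K) x) * f x"
      by auto
    obtain h where "\<And>x. f x = mpoly_eval x h" using polyfun_imp_mpoly_eval[OF f(1)] by blast
    then have h: "\<theta> ?q = ?q * h"
      by (intro mpoly_eqI) (simp add: f(2) mpoly_eval_simps mpoly_eval_linear_form)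
    \<comment> \<open>\<open>\<epsilon>\<^sub>m\<close> multiplies \<open>?q\<close> by \<open>m!\<close>, so \<open>w\<close> has the same value on \<open>?q\<close> as \<open>\<theta>\<close>\<close>
    define w where "w = op_scale (Const (inverse (fact m)) * h) (euler_op m)"
    have "w ?q = (Const (inverse (fact m)) * Const (fact m)) * (?q * h)"
      unfolding w_def euler(2) by (simp add: mult_ac)
    also have "\<dots> = ?q * h" unfolding Const_mult[symmetric] by (simp add: Const_1)
    finally have "\<theta> - w \<in> Xi_ops m A p Hs"
      unfolding Xi_iff using ops.subspace_diff[OF subspace_hom_arr_ops \<theta> euler(1)] h by (simp add: w_def)
    moreover have "w \<in> ops.span {euler_op m}" unfolding span_euler w_def by blast
    moreover have "\<theta> = (\<theta> - w) + w" by simp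
    ultimately show "\<theta> \<in> {u + w | u w. u \<in> Xi_ops m A p Hs \<and> w \<in> ops.span {euler_op m}}" by blast
  next
    fix \<theta> assume "\<theta> \<in> {u + w | u w. u \<in> Xi_ops m A p Hs \<and> w \<in> ops.span {euler_op m}}"
    then obtain u k where "\<theta> = u + op_scale k (euler_op m)" "u \<in> hom_arr_ops m A p"
      unfolding span_euler Xi_iff by blast
    then show "\<theta> \<in> hom_arr_ops m A p"
      using ops.subspace_add[OF subspace_hom_arr_ops _ euler(1)] by blast
  qed
  moreover have "Xi_ops m A p Hs \<inter> ops.span {euler_op m} = {0}"
  proof (intro equalityI subsetI)
    fix \<theta> assume "\<theta> \<in> Xi_ops m A p Hs \<inter> ops.span {euler_op m}"
    then obtain k where k: "\<theta> = op_scale k (euler_op m)" "\<theta> ?q = 0"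
      unfolding span_euler Int_iff Xi_iff by auto
    have "\<forall>x\<in>UNIV. mpoly_eval x k = 0"
    proof (rule polyfun_prod_mult_eq_0_on_subspace[OF finR0 vec.subspace_UNIV polyfun_mpoly_eval])
      show "\<exists>u\<in>UNIV. dotp (a K) u \<noteq> 0" if "K \<in> R0" for K
        using generic_on_ex_neq_0[OF gen _ nA, of K] n2 R0 that by auto
      fix x
      have "mpoly_eval x (k * Const (fact m) * ?q) = 0"
        using k(2) unfolding k(1) euler(2) by (simp only: mpoly_eval_0)
      then show "(\<Prod>K\<in>R0. dotp (a K) x) * mpoly_eval x k = 0"
        by (simp add: mpoly_eval_mult mpoly_eval_Const mpoly_eval_prod mpoly_eval_linear_form disj_commute)
    qed
    then have "k = 0" by (intro mpoly_eqI) (simp add: mpoly_eval_0)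
    then show "\<theta> \<in> {0}" using k(1) by (simp add: op_scale_def fun_eq_iff)
  next
    fix \<theta> :: "('k, 'n) mop" assume "\<theta> \<in> {0}"
    then show "\<theta> \<in> Xi_ops m A p Hs \<inter> ops.span {euler_op m}"
      using ops.subspace_0[OF subspace_Xi_ops] ops.span_zero by auto
  qed
  ultimately have direct: "internal_direct_sum (hom_arr_ops m A p) (Xi_ops m A p Hs) (ops.span {euler_op m})"
    unfolding internal_direct_sum_def using subspace_Xi_ops ops.subspace_span by blast
  have "ops.span G' \<noteq> Xi_ops m A p Hs" if G': "G' \<subset> Xi_gens m A p \<delta> Hs" for G'
  proof -
    obtain T where T: "T \<in> ?M" "?G T \<notin> G'" using G' unfolding gens by blast
    note T' = MD[OF T(1)]
    have finT: "finite T" using T'(1) fin finite_subset by blast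
    have "m \<le> card (A - T)" using card T' finT by (simp add: card_Diff_subset)
    then obtain R where R: "R \<subseteq> A - T" "card R = m" by (meson obtain_subset_with_card_n)
    then have finR: "finite R" using fin by (meson finite_Diff finite_subset)
    let ?f = "\<Prod>K\<in>R. linear_form (a K) :: ('k, 'n) mpoly"
    \<comment> \<open>evaluation on \<open>?f\<close> at the point \<open>v T\<close> separates the generator of \<open>T\<close> from all others\<close>
    let ?V = "{\<theta> :: ('k, 'n) mop. mpoly_eval (v T) (\<theta> ?f) = 0}"
    have "ops.span G' \<subseteq> ?V"
    proof (rule ops.span_minimal)
      show "ops.subspace ?V"
        by (rule ops.subspaceI) (auto simp: op_scale_def mpoly_eval_add mpoly_eval_mult mpoly_eval_0)
      show "G' \<subseteq> ?V"
      proof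
        fix \<theta> assume "\<theta> \<in> G'"
        then obtain T1 where T1: "\<theta> = ?G T1" "T1 \<in> ?M" "T1 \<noteq> T" using G' T(2) unfolding gens by blast
        have "card T1 = card T" using MD(2)[OF T1(2)] T'(2) by simp
        moreover have "finite T1" using MD(1)[OF T1(2)] fin finite_subset by blast
        ultimately have "\<not> T \<subseteq> T1" using T1(3) card_subset_eq by metis
        then obtain K where K: "K \<in> T" "K \<in> A - T1" using T'(1) by blast
        then have "dotp (a K) (v T) = 0" using v[OF T'(1,2)] by blast
        then have "(\<Prod>K\<in>A - T1. dotp (a K) (v T)) = 0" using K(2) fin by auto
        then show "\<theta> \<in> ?V"
          unfolding T1(1) by (simp add: op_scale_def mpoly_eval_mult mpoly_eval_prod mpoly_eval_linear_form)
      qed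
    qed
    moreover have "?G T \<notin> ?V"
    proof -
      have nz: "(\<Prod>K\<in>B. dotp (a K) (v T)) \<noteq> 0" if "B \<subseteq> A - T" for B
        using generic_on_form_neq_0[OF gen T'(1,2)] that fin
        by (metis (no_types, lifting) finite_Diff finite_subset prod_zero_iff subsetD)
      have "mpoly_eval (v T) (?G T ?f) =
          (\<Prod>K\<in>A - T. dotp (a K) (v T)) * (fact m * (\<Prod>K\<in>R. dotp (a K) (v T)))"
        by (simp add: op_scale_def powR[OF finR R(2)] mpoly_eval_mult mpoly_eval_Const mpoly_eval_prod
            mpoly_eval_linear_form)
      then show ?thesis using nz[of "A - T"] nz[OF R(1)] by simp
    qed
    ultimately show ?thesis using gen_in[OF T(1)] by blast
  qed
  then have "minimal_generators (Xi_gens m A p \<delta> Hs) (Xi_ops m A p Hs)"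
    unfolding minimal_generators_def using span_eq by blast
  then show ?thesis using direct by (simp add: span_eq)
qed

end
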